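(* For any integers $k\ge 2$ and $t\ge 2$, $$\operatorname{ex}(n,E^+_{k,t})=O\left(n^{\frac{3k-1}{2k-1}}\right)\quad\text{as } n\to\infty,$$ where the implied constant may depend on $k$ and $t$.
   Context: All graphs are finite and simple. The extremal number $\operatorname{ex}(n,H)$ is the maximum number of edges in an $n$-vertex graph containing no (not necessarily induced) subgraph isomorphic to $H$. For $k,t\ge 2$, the theta graph $\theta_{k,t}$ consists of two vertices joined by $t$ internally vertex-disjoint paths of length $k$ (that is, with $k$ edges); it is a connected bipartite graph, with bipartition $A\cup B$. The graph $E_{k,t}$ is obtained from $\theta_{k,t}$ by adding two new vertices $x,y$, joining $x$ to every vertex of $A$ and $y$ to every vertex of $B$. The graph $E^+_{k,t}$ is obtained from $E_{k,t}$ by adding the edge $xy$. *)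

theory Defs
  imports Complex_Main "HOL-Library.Landau_Symbols"
begin

(* A graph is a pair of a vertex set and a set of edges, an edge being a two-element set. *)
type_synonym 'a graph = "'a set \<times> 'a set set"

definition simple_graph :: "'a graph \<Rightarrow> bool" where
  "simple_graph G \<longleftrightarrow> finite (fst G) \<and> (\<forall>e\<in>snd G. e \<subseteq> fst G \<and> card e = 2)"

definition contains_copy :: "'a graph \<Rightarrow> 'b graph \<Rightarrow> bool" where
  "contains_copy G H \<longleftrightarrow>
     (\<exists>f. inj_on f (fst H) \<and> f ` fst H \<subseteq> fst G \<and> (\<forall>e\<in>snd H. f ` e \<in> snd G))"

(* Every finite graph is isomorphic to one whose vertices are natural numbers.  The maximum is
   over a finite set, nonempty if H has an edge: see finite_H_free_sizes, H_free_sizes_nonempty. *)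
definition extremal_number :: "nat \<Rightarrow> 'b graph \<Rightarrow> nat" where
  "extremal_number n H =
     Max {card (snd G) |G :: nat graph.
            simple_graph G \<and> card (fst G) = n \<and> \<not> contains_copy G H}"

definition bipartition :: "'a graph \<Rightarrow> 'a set \<Rightarrow> 'a set \<Rightarrow> bool" where
  "bipartition G A B \<longleftrightarrow> A \<union> B = fst G \<and> A \<inter> B = {} \<and>
     (\<forall>e\<in>snd G. \<exists>a\<in>A. \<exists>b\<in>B. e = {a, b})"

(* Source and Sink are the two common ends of the paths; Inner i j is the vertex at distance j
   from Source along the i-th path. *)
datatype theta_vertex = Source | Sink | Inner nat nat

definition path_vertex :: "nat \<Rightarrow> nat \<Rightarrow> nat \<Rightarrow> theta_vertex" where
  "path_vertex k i j = (if j = 0 then Source else if j = k then Sink else Inner i j)"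

definition theta_graph :: "nat \<Rightarrow> nat \<Rightarrow> theta_vertex graph" where
  "theta_graph k t =
     ({path_vertex k i j |i j. i < t \<and> j \<le> k},
      {{path_vertex k i j, path_vertex k i (Suc j)} |i j. i < t \<and> j < k})"

(* The bipartition of theta_graph k t, which is unique up to exchanging the two classes
   (theta_bipartition, theta_bipartition_unique); exchanging them only exchanges the roles of
   the two added vertices below. *)
definition theta_A :: "nat \<Rightarrow> nat \<Rightarrow> theta_vertex set" where
  "theta_A k t = {path_vertex k i j |i j. i < t \<and> j \<le> k \<and> even j}"

definition theta_B :: "nat \<Rightarrow> nat \<Rightarrow> theta_vertex set" where
  "theta_B k t = {path_vertex k i j |i j. i < t \<and> j \<le> k \<and> odd j}"

datatype E_vertex = Theta theta_vertex | X | Y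

definition E_graph :: "nat \<Rightarrow> nat \<Rightarrow> E_vertex graph" where
  "E_graph k t =
     (Theta ` fst (theta_graph k t) \<union> {X, Y},
      (\<lambda>e. Theta ` e) ` snd (theta_graph k t)
        \<union> {{X, Theta a} |a. a \<in> theta_A k t}
        \<union> {{Y, Theta b} |b. b \<in> theta_B k t})"

definition E_plus_graph :: "nat \<Rightarrow> nat \<Rightarrow> E_vertex graph" where
  "E_plus_graph k t = (fst (E_graph k t), insert {X, Y} (snd (E_graph k t)))"

lemma finite_H_free_sizes:
  "finite {card (snd G) |G :: nat graph.
            simple_graph G \<and> card (fst G) = n \<and> \<not> contains_copy G H}"
proof (rule finite_subset)
  show "{card (snd G) |G :: nat graph.
          simple_graph G \<and> card (fst G) = n \<and> \<not> contains_copy G H} \<subseteq> {..2 ^ n}"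
  proof clarify
    fix V :: "nat set" and E
    assume G: "simple_graph (V, E)"
    then have V: "finite V" and "E \<subseteq> Pow V"
      by (auto simp: simple_graph_def)
    then have "card E \<le> card (Pow V)"
      by (intro card_mono) auto
    then show "card (snd (V, E)) \<le> 2 ^ card (fst (V, E))"
      using V by (simp add: card_Pow)
  qed
qed simp

lemma H_free_sizes_nonempty:
  assumes "snd H \<noteq> {}"
  shows "{card (snd G) |G :: nat graph.
            simple_graph G \<and> card (fst G) = n \<and> \<not> contains_copy G H} \<noteq> {}"
proof -
  have "simple_graph ({..<n}, {})" "\<not> contains_copy ({..<n}, {}) H"
    using assms by (auto simp: simple_graph_def contains_copy_def)
  then have "simple_graph ({..<n}, {}) \<and> card (fst ({..<n}, {})) = n \<and>
      \<not> contains_copy ({..<n}, {}) H"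
    by simp
  then show ?thesis
    by blast
qed

lemma path_vertex_eq_iff:
  assumes "j \<le> k" "j' \<le> k"
  shows "path_vertex k i j = path_vertex k i' j' \<longleftrightarrow>
           j = j' \<and> (j = 0 \<or> j = k \<or> i = i')"
  using assms by (auto simp: path_vertex_def)

lemma path_vertex_in:
  assumes "i < t" "j \<le> k"
  shows "path_vertex k i j \<in> fst (theta_graph k t)"
    and "even j \<Longrightarrow> path_vertex k i j \<in> theta_A k t"
    and "odd j \<Longrightarrow> path_vertex k i j \<in> theta_B k t"
  using assms unfolding theta_graph_def theta_A_def theta_B_def fst_conv by blast+

lemma path_edge_in:
  assumes "i < t" "j < k"
  shows "{path_vertex k i j, path_vertex k i (Suc j)} \<in> snd (theta_graph k t)"
  using assms unfolding theta_graph_def snd_conv by blast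

lemma theta_graph_simple: "simple_graph (theta_graph k t)"
proof -
  have "fst (theta_graph k t) = (\<lambda>(i, j). path_vertex k i j) ` ({..<t} \<times> {..k})"
    by (auto simp: theta_graph_def)
  then have "finite (fst (theta_graph k t))"
    by simp
  moreover have "e \<subseteq> fst (theta_graph k t) \<and> card e = 2" if "e \<in> snd (theta_graph k t)" for e
  proof -
    from that obtain i j where ij: "i < t" "j < k"
      and e: "e = {path_vertex k i j, path_vertex k i (Suc j)}"
      by (auto simp: theta_graph_def)
    then have "path_vertex k i j \<noteq> path_vertex k i (Suc j)"
      by (simp add: path_vertex_eq_iff)
    moreover have "e \<subseteq> fst (theta_graph k t)"
      using ij by (simp add: e path_vertex_in)
    ultimately show ?thesis
      by (simp add: e)
  qed
  ultimately show ?thesis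
    by (simp add: simple_graph_def)
qed

lemma theta_bipartition: "bipartition (theta_graph k t) (theta_A k t) (theta_B k t)"
  unfolding bipartition_def
proof (intro conjI ballI)
  show "theta_A k t \<union> theta_B k t = fst (theta_graph k t)"
    by (auto simp: theta_A_def theta_B_def theta_graph_def)
  show "theta_A k t \<inter> theta_B k t = {}"
    by (auto simp: theta_A_def theta_B_def path_vertex_eq_iff)
  fix e assume "e \<in> snd (theta_graph k t)"
  then obtain i j where ij: "i < t" "j < k"
    and e: "e = {path_vertex k i j, path_vertex k i (Suc j)}"
    by (auto simp: theta_graph_def)
  show "\<exists>a\<in>theta_A k t. \<exists>b\<in>theta_B k t. e = {a, b}"
  proof (cases "even j")
    case True
    then have "path_vertex k i j \<in> theta_A k t" "path_vertex k i (Suc j) \<in> theta_B k t"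
      using ij by (simp_all add: path_vertex_in)
    then show ?thesis using e by blast
  next
    case False
    then have "path_vertex k i (Suc j) \<in> theta_A k t" "path_vertex k i j \<in> theta_B k t"
      using ij by (simp_all add: path_vertex_in)
    then show ?thesis using e by blast
  qed
qed

lemma theta_bipartition_unique:
  assumes AB: "bipartition (theta_graph k t) A B"
  shows "A = theta_A k t \<and> B = theta_B k t \<or> A = theta_B k t \<and> B = theta_A k t"
proof -
  have un: "A \<union> B = fst (theta_graph k t)" and disj: "A \<inter> B = {}"
    and ed: "\<And>e. e \<in> snd (theta_graph k t) \<Longrightarrow> \<exists>a\<in>A. \<exists>b\<in>B. e = {a, b}"
    using AB by (auto simp: bipartition_def)
  have aux: "path_vertex k i j \<in> A \<longleftrightarrow> (Source \<in> A \<longleftrightarrow> even j)" if "i < t" "j \<le> k" for i j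
    using that(2)
  proof (induction j)
    case 0
    then show ?case by (simp add: path_vertex_def)
  next
    case (Suc j)
    then have "{path_vertex k i j, path_vertex k i (Suc j)} \<in> snd (theta_graph k t)"
      using that(1) by (intro path_edge_in) auto
    from ed[OF this] obtain a b where "a \<in> A" "b \<in> B"
      "{path_vertex k i j, path_vertex k i (Suc j)} = {a, b}"
      by blast
    then have "path_vertex k i (Suc j) \<in> A \<longleftrightarrow> path_vertex k i j \<notin> A"
      using disj by (auto simp: doubleton_eq_iff)
    with Suc show ?case by simp
  qed
  have A: "A = {path_vertex k i j |i j. i < t \<and> j \<le> k \<and> (Source \<in> A \<longleftrightarrow> even j)}"
    (is "A = ?R")
  proof (intro equalityI subsetI)
    fix v assume v: "v \<in> A"
    then have "v \<in> fst (theta_graph k t)"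
      using un by blast
    then obtain i j where "i < t" "j \<le> k" "v = path_vertex k i j"
      by (auto simp: theta_graph_def)
    with v aux[of i j] show "v \<in> ?R"
      by blast
  next
    fix v assume "v \<in> ?R"
    then show "v \<in> A"
      using aux by blast
  qed
  have B: "B = fst (theta_graph k t) - A"
    using un disj by blast
  have th: "fst (theta_graph k t) = theta_A k t \<union> theta_B k t" "theta_A k t \<inter> theta_B k t = {}"
    using theta_bipartition[of k t] by (auto simp: bipartition_def)
  show ?thesis
  proof (cases "Source \<in> A")
    case True
    then have "A = theta_A k t"
      using A by (simp add: theta_A_def)
    then show ?thesis using B th by blast
  next
    case False
    then have "A = theta_B k t"
      using A by (simp add: theta_B_def)
    then show ?thesis using B th by blast
  qed
qed

lemma E_plus_graph_simple: "simple_graph (E_plus_graph k t)"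
proof -
  have fin: "finite (fst (theta_graph k t))"
    and edges: "\<And>e. e \<in> snd (theta_graph k t) \<Longrightarrow> e \<subseteq> fst (theta_graph k t) \<and> card e = 2"
    using theta_graph_simple[of k t] by (auto simp: simple_graph_def)
  have AB: "theta_A k t \<subseteq> fst (theta_graph k t)" "theta_B k t \<subseteq> fst (theta_graph k t)"
    using theta_bipartition[of k t] by (auto simp: bipartition_def)
  have "card (Theta ` e) = card e" for e
    by (intro card_image) (simp add: inj_on_def)
  then show ?thesis
    using fin edges AB by (fastforce simp: simple_graph_def E_plus_graph_def E_graph_def)
qed

end

theory Submission
  imports Defs "HOL-Analysis.Convex"
begin

text \<open>
  The exponent comes from the Erdos-Simonovits reduction applied to the bound of Faudree and
  Simonovits: a graph on \<open>m\<close> vertices with at least \<open>C m^(1 + 1/k)\<close> edges contains the theta graph.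
  Pass to a bipartite subgraph whose maximum degree is at most a constant times its average
  degree \<open>d\<close>.  Counting four-cycles gives an edge \<open>xy\<close> with at least \<open>d\<^sup>3 / n\<close> edges between the
  neighbourhoods of \<open>x\<close> and \<open>y\<close>, which have size \<open>O(d)\<close>.  If \<open>d\<close> is a large multiple of
  \<open>n^(k/(2k - 1))\<close>, these edges contain a theta graph, and adding \<open>x\<close> and \<open>y\<close> completes it; the
  two added vertices may be exchanged, so it does not matter on which side its source lies.

  For the theta graph itself, call a pair of vertices rich if many short paths join it.  The
  paths of length \<open>k\<close> without a rich subpath are bounded above because few of them join each
  pair, and below because in a theta-free graph only a lower-order number of walks has a rich
  subpath.
\<close>

section \<open>Theta graphs from families of paths\<close>

text \<open>The exponent k/(2k - 1) marks a balance. Neighbourhoods of size O(d) with d^3/n edges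
  between them have density \<delta> of order d^2/n, and the theta bound needs \<delta>^k to exceed
  a multiple of their size d; that is, d^(2k - 1) must exceed a multiple of n^k. Larger
  neighbourhoods with as few edges between them would spoil this, hence the bound on the maximum
  degree. The obstacle in the theta bound is that many paths of length i < k between two vertices
  give a theta graph of the wrong length, so they have to be prolonged to length exactly k.
  Considering only rich paths without shorter rich subpaths helps twice: few of them pass through a
  given inner vertex, so some avoid any small set, and few share a last edge, so the last edges are
  numerous. It follows that such paths with i + 1 edges from a fixed vertex number O(d^i), a factor
  d below the trivial bound.\<close>

lemma min_degree_subrelation:
  fixes E :: "('a \<times> 'b) set" and s :: nat
  assumes "finite P" "finite Q" "E \<subseteq> P \<times> Q" "card E > s * (card P + card Q)"
  shows "\<exists>P' Q'. P' \<subseteq> P \<and> Q' \<subseteq> Q \<and> P' \<noteq> {} \<and> Q' \<noteq> {} \<and>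
    (\<forall>p\<in>P'. card {q \<in> Q'. (p, q) \<in> E} > s) \<and> (\<forall>q\<in>Q'. card {p \<in> P'. (p, q) \<in> E} > s)"
proof -
  \<comment> \<open>Deleting a vertex of degree at most \<open>s\<close> loses at most
    \<open>s\<close> edges and so preserves the inequality; a dense pair with fewest vertices has no
    such vertex.\<close>
  define dense where "dense = (\<lambda>(P', Q'). P' \<subseteq> P \<and> Q' \<subseteq> Q \<and>
      card (E \<inter> P' \<times> Q') > s * (card P' + card Q'))"
  have "dense (P, Q)"
    using assms by (simp add: dense_def Int_absorb2)
  then obtain Z where Z: "dense Z"
    and min: "\<And>Z'. dense Z' \<Longrightarrow> card (fst Z) + card (snd Z) \<le> card (fst Z') + card (snd Z')"
    using ex_has_least_nat[of dense _ "\<lambda>Z. card (fst Z) + card (snd Z)"] by metis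
  obtain P' Q' where PQ: "Z = (P', Q')" by fastforce
  have sub: "P' \<subseteq> P" "Q' \<subseteq> Q" and big: "card (E \<inter> P' \<times> Q') > s * (card P' + card Q')"
    using Z by (auto simp: dense_def PQ)
  have fin: "finite P'" "finite Q'"
    using sub assms by (auto intro: finite_subset)
  have "E \<inter> P' \<times> Q' \<noteq> {}"
    using big by force
  then have ne: "P' \<noteq> {}" "Q' \<noteq> {}"
    by auto
  have p: "card {q \<in> Q'. (p, q) \<in> E} > s" if "p \<in> P'" for p
  proof (rule ccontr)
    assume le: "\<not> ?thesis"
    have split: "E \<inter> P' \<times> Q' = E \<inter> (P' - {p}) \<times> Q' \<union> Pair p ` {q \<in> Q'. (p, q) \<in> E}"
      using that by auto
    have "card (E \<inter> P' \<times> Q') \<le> card (E \<inter> (P' - {p}) \<times> Q') + card (Pair p ` {q \<in> Q'. (p, q) \<in> E})"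
      unfolding split by (rule card_Un_le)
    also have "card (Pair p ` {q \<in> Q'. (p, q) \<in> E}) \<le> s"
      using le card_image_le[of "{q \<in> Q'. (p, q) \<in> E}" "Pair p"] fin by simp
    finally have "card (E \<inter> P' \<times> Q') \<le> card (E \<inter> (P' - {p}) \<times> Q') + s"
      by simp
    moreover have "card P' = Suc (card (P' - {p}))"
      using that fin by (metis card_Suc_Diff1)
    ultimately have "dense (P' - {p}, Q')"
      using big sub by (auto simp: dense_def)
    from min[OF this] show False
      using \<open>card P' = _\<close> by (simp add: PQ)
  qed
  have q: "card {p \<in> P'. (p, q) \<in> E} > s" if "q \<in> Q'" for q
  proof (rule ccontr)
    assume le: "\<not> ?thesis"
    have split: "E \<inter> P' \<times> Q' = E \<inter> P' \<times> (Q' - {q}) \<union> (\<lambda>p. (p, q)) ` {p \<in> P'. (p, q) \<in> E}"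
      using that by auto
    have "card (E \<inter> P' \<times> Q') \<le> card (E \<inter> P' \<times> (Q' - {q})) + card ((\<lambda>p. (p, q)) ` {p \<in> P'. (p, q) \<in> E})"
      unfolding split by (rule card_Un_le)
    also have "card ((\<lambda>p. (p, q)) ` {p \<in> P'. (p, q) \<in> E}) \<le> s"
      using le card_image_le[of "{p \<in> P'. (p, q) \<in> E}" "\<lambda>p. (p, q)"] fin by simp
    finally have "card (E \<inter> P' \<times> Q') \<le> card (E \<inter> P' \<times> (Q' - {q})) + s"
      by simp
    moreover have "card Q' = Suc (card (Q' - {q}))"
      using that fin by (metis card_Suc_Diff1)
    ultimately have "dense (P', Q' - {q})"
      using big sub by (auto simp: dense_def)
    from min[OF this] show False
      using \<open>card Q' = _\<close> by (simp add: PQ)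
  qed
  show ?thesis
    using sub ne p q by blast
qed

text \<open>A bare relation instead of a \<open>graph\<close>, so that the same notion serves the
  symmetrised arcs of \<open>out_regular\<close> and a bipartite relation read in both
  directions.\<close>

definition has_theta :: "nat \<Rightarrow> nat \<Rightarrow> ('a \<Rightarrow> 'a \<Rightarrow> bool) \<Rightarrow> bool" where
  "has_theta k t adj \<longleftrightarrow> (\<exists>f. inj_on f (fst (theta_graph k t)) \<and>
     (\<forall>i<t. \<forall>j<k. adj (f (path_vertex k i j)) (f (path_vertex k i (Suc j)))))"

definition path_between :: "('a \<Rightarrow> 'a \<Rightarrow> bool) \<Rightarrow> nat \<Rightarrow> 'a \<Rightarrow> 'a \<Rightarrow> 'a list \<Rightarrow> bool" where
  "path_between adj k x y p \<longleftrightarrow>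
     length p = Suc k \<and> distinct p \<and> successively adj p \<and> hd p = x \<and> last p = y"

lemma path_between_nth:
  assumes "path_between adj k x y p"
  shows "p ! 0 = x" "p ! k = y"
    and "j < k \<Longrightarrow> adj (p ! j) (p ! Suc j)"
    and "\<lbrakk>i \<le> k; j \<le> k\<rbrakk> \<Longrightarrow> p ! i = p ! j \<longleftrightarrow> i = j"
proof -
  have p: "p \<noteq> []" "length p = Suc k" "distinct p" "successively adj p" "hd p = x" "last p = y"
    using assms by (auto simp: path_between_def)
  show "p ! 0 = x" "p ! k = y"
    using p by (simp_all add: hd_conv_nth last_conv_nth)
  show "j < k \<Longrightarrow> adj (p ! j) (p ! Suc j)"
    using p by (simp add: successively_conv_nth)
  show "\<lbrakk>i \<le> k; j \<le> k\<rbrakk> \<Longrightarrow> p ! i = p ! j \<longleftrightarrow> i = j"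
    using p by (simp add: nth_eq_iff_index_eq)
qed

text \<open>A path meets \<open>x\<close> only at position 0 and \<open>y\<close> only at position
  \<open>k\<close>, so a vertex common to two of the paths has the same extreme position on both.
  These are exactly the identifications made by \<open>path_vertex\<close>.\<close>

lemma has_theta_if_paths:
  assumes p: "\<And>i. i < t \<Longrightarrow> path_between adj k x y (p i)"
    and disj: "\<And>i i'. \<lbrakk>i < t; i' < i\<rbrakk> \<Longrightarrow> set (p i) \<inter> set (p i') \<subseteq> {x, y}"
  shows "has_theta k t adj"
proof -
  define f where "f v = (case v of Source \<Rightarrow> x | Sink \<Rightarrow> y | Inner i j \<Rightarrow> p i ! j)" for v
  have f: "f (path_vertex k i j) = p i ! j" if "i < t" "j \<le> k" for i j
    using path_between_nth(1,2)[OF p[OF that(1)]] that by (auto simp: f_def path_vertex_def)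
  have ends: "j = j' \<and> (j = 0 \<or> j = k)"
    if ij: "i < t" "i' < i" "j \<le> k" "j' \<le> k" "p i ! j = p i' ! j'" for i i' j j'
  proof -
    have "i' < t" using that by simp
    note pi = p[OF that(1)] and pi' = p[OF \<open>i' < t\<close>]
    have "length (p i) = Suc k" "length (p i') = Suc k"
      using pi pi' by (auto simp: path_between_def)
    then have "p i ! j \<in> set (p i)" "p i ! j \<in> set (p i')"
      using nth_mem[of j "p i"] nth_mem[of j' "p i'"] that by auto
    then consider "p i ! j = x" | "p i ! j = y"
      using disj[OF ij(1,2)] by blast
    then show ?thesis
    proof cases
      case 1
      then have "p i ! j = p i ! 0" "p i' ! j' = p i' ! 0"
        using path_between_nth(1)[OF pi] path_between_nth(1)[OF pi'] ij by auto
      then show ?thesis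
        using path_between_nth(4)[OF pi, of j 0] path_between_nth(4)[OF pi', of j' 0] ij by simp
    next
      case 2
      then have "p i ! j = p i ! k" "p i' ! j' = p i' ! k"
        using path_between_nth(2)[OF pi] path_between_nth(2)[OF pi'] ij by auto
      then show ?thesis
        using path_between_nth(4)[OF pi, of j k] path_between_nth(4)[OF pi', of j' k] ij by simp
    qed
  qed
  have "inj_on f (fst (theta_graph k t))"
  proof (rule inj_onI)
    fix u v assume "u \<in> fst (theta_graph k t)" "v \<in> fst (theta_graph k t)" and eq: "f u = f v"
    then obtain i j i' j' where ij: "u = path_vertex k i j" "i < t" "j \<le> k"
      "v = path_vertex k i' j'" "i' < t" "j' \<le> k"
      by (auto simp: theta_graph_def)
    then have e: "p i ! j = p i' ! j'"
      using eq f by simp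
    consider "i = i'" | "i' < i" | "i < i'" by linarith
    then have "j = j' \<and> (j = 0 \<or> j = k \<or> i = i')"
      using e ij path_between_nth(4)[OF p[OF ij(2)]] ends[of i i' j j'] ends[of i' i j' j]
      by cases auto
    then show "u = v"
      using ij by (auto simp: path_vertex_eq_iff)
  qed
  moreover have "\<forall>i<t. \<forall>j<k. adj (f (path_vertex k i j)) (f (path_vertex k i (Suc j)))"
    by (simp add: f path_between_nth(3)[OF p])
  ultimately show ?thesis
    unfolding has_theta_def by blast
qed

text \<open>The bound on \<open>card F\<close> is the size of a union of \<open>t\<close> paths with
  \<open>Suc k\<close> vertices each: the paths already found are forbidden, apart from the common
  ends.\<close>

lemma has_theta_greedy:
  assumes "\<And>F. \<lbrakk>finite F; card F \<le> t * Suc k\<rbrakk> \<Longrightarrow>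
             \<exists>p. path_between adj k x y p \<and> set p \<inter> F \<subseteq> {x, y}"
  shows "has_theta k t adj"
proof -
  have "\<exists>p. (\<forall>i<m. path_between adj k x y (p i)) \<and>
      (\<forall>i<m. \<forall>i'<i. set (p i) \<inter> set (p i') \<subseteq> {x, y})" if "m \<le> t" for m
    using that
  proof (induction m)
    case 0
    then show ?case by simp
  next
    case (Suc m)
    then obtain p where p: "\<forall>i<m. path_between adj k x y (p i)"
      "\<forall>i<m. \<forall>i'<i. set (p i) \<inter> set (p i') \<subseteq> {x, y}"
      by auto
    have "card (\<Union>i<m. set (p i)) \<le> (\<Sum>i<m. card (set (p i)))"
      by (rule card_UN_le) simp
    also have "\<dots> \<le> (\<Sum>i<m. Suc k)"
      using p(1) by (intro sum_mono) (auto simp: path_between_def intro: order_trans[OF card_length])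
    also have "\<dots> \<le> t * Suc k"
      using Suc.prems mult_le_mono1[of m t "Suc k"] by simp
    finally obtain q where q: "path_between adj k x y q" "set q \<inter> (\<Union>i<m. set (p i)) \<subseteq> {x, y}"
      using assms[of "\<Union>i<m. set (p i)"] by auto
    have "(\<forall>i<Suc m. path_between adj k x y ((p(m := q)) i)) \<and>
      (\<forall>i<Suc m. \<forall>i'<i. set ((p(m := q)) i) \<inter> set ((p(m := q)) i') \<subseteq> {x, y})"
      using p q by (auto simp: less_Suc_eq)
    then show ?case by blast
  qed
  from this[of t] obtain p where "\<forall>i<t. path_between adj k x y (p i)"
    "\<forall>i<t. \<forall>i'<i. set (p i) \<inter> set (p i') \<subseteq> {x, y}"
    by auto
  then show ?thesis
    using has_theta_if_paths[of t adj k x y p] by blast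
qed

text \<open>Greedy descent: of more than \<open>s\<close> neighbours in the next layer,
  \<open>F\<close> and the vertices visited so far exclude at most \<open>s\<close>. The start may
  lie in \<open>F\<close>, hence \<open>tl p\<close>. Layers may overlap, so the two sides of a
  bipartite graph can alternate.\<close>

lemma path_in_layers:
  fixes Z :: "nat \<Rightarrow> 'a set"
  assumes Z: "\<And>l y. y \<in> Z (Suc l) \<Longrightarrow> card {z \<in> Z l. adj y z} > s"
    and "finite F" "card F + l \<le> s" "y \<in> Z l"
  shows "\<exists>p. \<exists>z\<in>Z 0. path_between adj l y z p \<and> set (tl p) \<inter> F = {} \<and> set p \<subseteq> \<Union> (range Z)"
  using assms(2-)
proof (induction l arbitrary: y F)
  case 0
  then show ?case
    by (intro exI[of _ "[y]"] bexI[of _ y]) (auto simp: path_between_def)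
next
  case (Suc l)
  have "\<not> {z \<in> Z l. adj y z} \<subseteq> insert y F"
  proof
    assume "{z \<in> Z l. adj y z} \<subseteq> insert y F"
    then have "card {z \<in> Z l. adj y z} \<le> card (insert y F)"
      using Suc.prems by (intro card_mono) auto
    also have "\<dots> \<le> Suc (card F)"
      by (rule card_insert_le_m1) auto
    finally show False
      using Z[OF Suc.prems(3)] Suc.prems by linarith
  qed
  then obtain z where z: "z \<in> Z l" "adj y z" "z \<noteq> y" "z \<notin> F"
    by auto
  have "card (insert y F) + l \<le> s"
    using Suc.prems by (simp add: card_insert_if)
  from Suc.IH[OF _ this z(1)] obtain p z' where p: "z' \<in> Z 0" "path_between adj l z z' p"
    "set (tl p) \<inter> insert y F = {}" "set p \<subseteq> \<Union> (range Z)"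
    using Suc.prems by auto
  then have "p \<noteq> []" "hd p = z"
    by (auto simp: path_between_def)
  then have pz: "p = z # tl p"
    by (metis list.collapse)
  then have "set p = insert z (set (tl p))"
    by (metis list.simps(15))
  then have "path_between adj (Suc l) y z' (y # p)" "set (tl (y # p)) \<inter> F = {}"
    using p z \<open>p \<noteq> []\<close> \<open>hd p = z\<close>
    by (auto simp: path_between_def successively_Cons)
  moreover have "set (y # p) \<subseteq> \<Union> (range Z)"
    using p(4) Suc.prems(3) by auto
  ultimately show ?case
    using p(1) by blast
qed

section \<open>The Faudree-Simonovits bound\<close>

lemma card_eq_sum_fibres:
  assumes "finite A"
  shows "card A = (\<Sum>y\<in>f ` A. card {x \<in> A. f x = y})"
  using sum.image_gen[OF assms, of "\<lambda>_. 1::nat" f] by simp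

lemma card_le_fibres:
  assumes "finite A" "\<And>y. y \<in> f ` A \<Longrightarrow> card {x \<in> A. f x = y} \<le> m"
  shows "card A \<le> m * card (f ` A)"
proof -
  have "card A \<le> (\<Sum>y\<in>f ` A. m)"
    unfolding card_eq_sum_fibres[OF assms(1), of f] by (intro sum_mono assms(2))
  then show ?thesis by (simp add: mult.commute)
qed

lemma card_ge_fibres:
  assumes "finite A" "\<And>y. y \<in> f ` A \<Longrightarrow> m \<le> card {x \<in> A. f x = y}"
  shows "m * card (f ` A) \<le> card A"
proof -
  have "(\<Sum>y\<in>f ` A. m) \<le> card A"
    unfolding card_eq_sum_fibres[OF assms(1), of f] by (intro sum_mono assms(2))
  then show ?thesis by (simp add: mult.commute)
qed

text \<open>The first summand covers the at most \<open>t\<close> earlier paths of the theta graph,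
  the second the at most \<open>k\<close> vertices of the connecting path.\<close>

definition spread :: "nat \<Rightarrow> nat \<Rightarrow> nat" where
  "spread k t = t * Suc k + k"

text \<open>The threshold of richness. For paths with \<open>Suc i\<close> edges, the square bounds
  those through a fixed inner vertex at a fixed position, \<open>Suc i\<close> the number of inner
  positions, and the first factor the size of a set to be avoided. So more than
  \<open>cap k t (Suc i)\<close> paths cannot all be hit by such a set. With at most
  \<open>cap k t i\<close> of them per last edge, they also have at least
  \<open>2 * spread k t\<close> different last edges.\<close>

primrec cap :: "nat \<Rightarrow> nat \<Rightarrow> nat \<Rightarrow> nat" where
  "cap k t 0 = 1"
| "cap k t (Suc i) = (2 * spread k t + 2) * Suc i * (cap k t i)\<^sup>2"

text \<open>The first summand comes from bad suffixes of one length, the 1 from steps back to a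
  vertex of the path; see \<open>card_good_from_step\<close>.\<close>

definition loss :: "nat \<Rightarrow> nat \<Rightarrow> nat" where
  "loss k t = 2 * spread k t * cap k t k + 1"

lemma cap_ge_1: "1 \<le> cap k t i"
  by (induction i) (auto simp: Suc_le_eq)

lemma cap_mono: "i \<le> j \<Longrightarrow> cap k t i \<le> cap k t j"
proof (rule lift_Suc_mono_le[of "cap k t"])
  fix i
  have "cap k t i * 1 \<le> cap k t i * (cap k t i * ((2 * spread k t + 2) * Suc i))"
    using cap_ge_1[of k t i] by (intro mult_le_mono2) (simp add: Suc_le_eq)
  then show "cap k t i \<le> cap k t (Suc i)"
    by (simp add: power2_eq_square algebra_simps)
qed

text \<open>
  Every vertex selects exactly \<open>d\<close> out-neighbours, so that walks from a fixed vertex are counted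
  from above and below without any bound on the maximum degree.
\<close>

locale out_regular =
  fixes V :: "'a set" and D :: "'a \<Rightarrow> 'a set" and d k t :: nat
  assumes finite_V: "finite V"
    and D_subset: "u \<in> V \<Longrightarrow> D u \<subseteq> V"
    and card_D: "u \<in> V \<Longrightarrow> card (D u) = d"
begin

abbreviation arc :: "'a \<Rightarrow> 'a \<Rightarrow> bool" where
  "arc u v \<equiv> v \<in> D u"

definition adj :: "'a \<Rightarrow> 'a \<Rightarrow> bool" where
  "adj u v \<longleftrightarrow> v \<in> D u \<or> u \<in> D v"

text \<open>Every proper subpath lies in \<open>tl p\<close> or in \<open>butlast p\<close>, so it
  suffices to impose the hereditary condition on these two.\<close>

definition extend :: "'a list set \<Rightarrow> 'a list set" where
  "extend S = {p. distinct p \<and> successively arc p \<and> tl p \<in> S \<and> butlast p \<in> S}"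

text \<open>
  A path is good if none of its subpaths, itself included, joins a pair of vertices that is
  joined by too many paths all of whose proper subpaths are good.
\<close>

primrec good :: "nat \<Rightarrow> 'a list set" where
  "good 0 = (\<lambda>v. [v]) ` V"
| "good (Suc i) = {p \<in> extend (good i).
     card {q \<in> extend (good i). hd q = hd p \<and> last q = last p} \<le> cap k t (Suc i)}"

text \<open>The minimal paths that are not good. The index is the length of their maximal proper
  subpaths: members of \<open>bad i\<close> have \<open>Suc i\<close> edges.\<close>

definition bad :: "nat \<Rightarrow> 'a list set" where
  "bad i = extend (good i) - good (Suc i)"

lemma extend_props:
  assumes "\<And>p. p \<in> S \<Longrightarrow> length p = Suc i \<and> set p \<subseteq> V" "p \<in> extend S"
  shows "length p = Suc (Suc i)" "distinct p" "successively arc p" "set p \<subseteq> V"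
    "tl p \<in> S" "butlast p \<in> S" "p = butlast p @ [last p]"
proof -
  have p: "distinct p" "successively arc p" "tl p \<in> S" "butlast p \<in> S"
    using assms(2) by (auto simp: extend_def)
  then show "distinct p" "successively arc p" "tl p \<in> S" "butlast p \<in> S"
    by auto
  show len: "length p = Suc (Suc i)"
    using assms(1)[OF p(3)] by (cases p) auto
  then have "p \<noteq> []" by auto
  then show "p = butlast p @ [last p]"
    by simp
  have "last p = last (tl p)" "tl p \<noteq> []"
    using len by (cases p; force)+
  then have "last p \<in> V"
    using assms(1)[OF p(3)] last_in_set by fastforce
  then have "set (butlast p @ [last p]) \<subseteq> V"
    using assms(1)[OF p(4)] by simp
  then show "set p \<subseteq> V"
    using \<open>p \<noteq> []\<close> by simp
qed

lemma good_length_set: "p \<in> good i \<Longrightarrow> length p = Suc i \<and> set p \<subseteq> V"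
proof (induction i arbitrary: p)
  case (Suc i)
  then show ?case
    using extend_props(1,4)[of "good i" i p] by simp
qed auto

lemma extend_good_props:
  assumes "p \<in> extend (good i)"
  shows "length p = Suc (Suc i)" "distinct p" "successively arc p" "set p \<subseteq> V"
    "tl p \<in> good i" "butlast p \<in> good i" "p = butlast p @ [last p]"
  using extend_props[of "good i" i p] good_length_set assms by auto

lemma last_V: "p \<in> good i \<Longrightarrow> last p \<in> V"
  using good_length_set[of p i] last_in_set[of p] by (cases p) auto

lemma finite_D: "u \<in> V \<Longrightarrow> finite (D u)"
  using D_subset finite_V by (rule finite_subset)

lemma good_distinct: "p \<in> good i \<Longrightarrow> distinct p \<and> successively arc p"
  by (cases i) (auto simp: extend_def)

lemma finite_good: "finite (good i)"
proof (rule finite_subset)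
  show "good i \<subseteq> {p. set p \<subseteq> V \<and> length p = Suc i}"
    using good_length_set by auto
qed (use finite_lists_length_eq[OF finite_V] in simp)

lemma finite_extend_good: "finite (extend (good i))"
proof (rule finite_subset)
  show "extend (good i) \<subseteq> {p. set p \<subseteq> V \<and> length p = Suc (Suc i)}"
    using extend_good_props(1,4) by blast
qed (use finite_lists_length_eq[OF finite_V] in simp)

section \<open>Subpaths of good paths and the number of paths between two vertices\<close>

lemma good_take: "\<lbrakk>p \<in> good i; j \<le> i\<rbrakk> \<Longrightarrow> take (Suc j) p \<in> good j"
proof (induction i arbitrary: p)
  case 0
  then show ?case by auto
next
  case (Suc i)
  then have p: "butlast p \<in> good i" "length p = Suc (Suc i)"
    using extend_good_props(1,6)[of p i] by auto
  show ?case
  proof (cases "j = Suc i")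
    case True
    then show ?thesis using Suc.prems p by simp
  next
    case False
    then have "take (Suc j) (butlast p) \<in> good j"
      using Suc p by simp
    moreover have "take (Suc j) (butlast p) = take (Suc j) p"
      using False Suc.prems p by (simp add: butlast_conv_take min_def)
    ultimately show ?thesis by simp
  qed
qed

lemma good_drop: "\<lbrakk>p \<in> good i; j \<le> i\<rbrakk> \<Longrightarrow> drop j p \<in> good (i - j)"
proof (induction i arbitrary: p j)
  case 0
  then show ?case by auto
next
  case (Suc i)
  then have p: "tl p \<in> good i"
    using extend_good_props(5)[of p i] by auto
  show ?case
  proof (cases j)
    case 0
    then show ?thesis using Suc.prems by simp
  next
    case (Suc j')
    then have "drop j' (tl p) \<in> good (i - j')"
      using Suc.IH[OF p] Suc.prems by simp
    then show ?thesis
      by (simp add: Suc drop_Suc)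
  qed
qed

text \<open>For ends that are joined by a good path at all, that path certifies the bound through
  the definition of \<open>good\<close>.\<close>

lemma card_good_between: "card {q \<in> good i. hd q = u \<and> last q = v} \<le> cap k t i"
proof (cases "{q \<in> good i. hd q = u \<and> last q = v} = {}")
  case True
  then show ?thesis by (simp only: card.empty)
next
  case False
  then obtain p where p: "p \<in> good i" "hd p = u" "last p = v" by blast
  show ?thesis
  proof (cases i)
    case 0
    then have "{q \<in> good i. hd q = u \<and> last q = v} \<subseteq> {[u]}" by auto
    then have "card {q \<in> good i. hd q = u \<and> last q = v} \<le> card {[u]}"
      by (intro card_mono) auto
    then show ?thesis by (simp add: 0)
  next
    case (Suc j)
    have "card {q \<in> good i. hd q = u \<and> last q = v}
        \<le> card {q \<in> extend (good j). hd q = u \<and> last q = v}"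
      using finite_extend_good by (intro card_mono) (auto simp: Suc)
    also have "\<dots> \<le> cap k t i"
      using p by (simp add: Suc)
    finally show ?thesis .
  qed
qed

text \<open>Cutting at the inner position \<open>l\<close> leaves two proper subpaths. Both are
  good, so each is one of at most \<open>cap k t i\<close> paths between its ends.\<close>

lemma card_extend_through:
  assumes l: "0 < l" "l \<le> i"
  shows "card {q \<in> extend (good i). hd q = u \<and> last q = v \<and> q ! l = z} \<le> (cap k t i)\<^sup>2"
proof -
  let ?Q = "{q \<in> extend (good i). hd q = u \<and> last q = v \<and> q ! l = z}"
  let ?A = "{q \<in> good l. hd q = u \<and> last q = z}"
  let ?B = "{q \<in> good (Suc i - l). hd q = z \<and> last q = v}"
  let ?f = "\<lambda>q. (take (Suc l) q, drop l q)"
  have "inj_on ?f ?Q"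
  proof (rule inj_onI)
    fix p q assume eq: "?f p = ?f q"
    have "drop (Suc l) p = drop (Suc l) q"
      using eq by (simp add: drop_Suc drop_tl)
    then show "p = q"
      using eq append_take_drop_id[of "Suc l"] by (metis prod.inject)
  qed
  moreover have "?f ` ?Q \<subseteq> ?A \<times> ?B"
  proof (rule image_subsetI)
    fix q assume q': "q \<in> ?Q"
    then have q: "q \<in> extend (good i)" by simp
    note p = extend_good_props[OF q]
    have "take (Suc l) (butlast q) \<in> good l"
      using good_take[OF p(6) l(2)] .
    moreover have "take (Suc l) (butlast q) = take (Suc l) q"
      using p(1) l by (simp add: butlast_conv_take min_def)
    ultimately have 1: "take (Suc l) q \<in> good l" by simp
    have "drop (l - 1) (tl q) \<in> good (i - (l - 1))"
      using good_drop[OF p(5), of "l - 1"] l by simp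
    then have 2: "drop l q \<in> good (Suc i - l)"
      using l by (cases l) (auto simp: drop_Suc)
    have lq: "q \<noteq> []" "l < length q" using p(1) l by auto
    have "hd (take (Suc l) q) = hd q" "last (take (Suc l) q) = q ! l"
      using lq by (simp, simp add: take_Suc_conv_app_nth)
    with lq q' show "?f q \<in> ?A \<times> ?B"
      using 1 2 by (simp add: hd_drop_conv_nth)
  qed
  moreover have "finite (?A \<times> ?B)"
    using finite_good by simp
  ultimately have "card ?Q \<le> card (?A \<times> ?B)"
    by (rule card_inj_on_le)
  also have "\<dots> \<le> cap k t l * cap k t (Suc i - l)"
    unfolding card_cartesian_product by (intro mult_le_mono card_good_between)
  also have "\<dots> \<le> cap k t i * cap k t i"
    using l by (intro mult_le_mono cap_mono) auto
  finally show ?thesis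
    by (simp add: power2_eq_square)
qed

text \<open>Union bound over the inner position and the vertex of \<open>F\<close> met there, with
  \<open>card_extend_through\<close> for each such pair.\<close>

lemma extend_avoiding:
  assumes F: "finite F" "card F \<le> 2 * spread k t + 1"
    and big: "card {q \<in> extend (good i). hd q = u \<and> last q = v} > cap k t (Suc i)"
  obtains q where "q \<in> extend (good i)" "hd q = u" "last q = v" "set q \<inter> F \<subseteq> {u, v}"
proof -
  have "\<exists>q\<in>{q \<in> extend (good i). hd q = u \<and> last q = v}. set q \<inter> F \<subseteq> {u, v}"
  proof (rule ccontr)
    assume none: "\<not> ?thesis"
    let ?S = "\<lambda>l z. {q \<in> extend (good i). hd q = u \<and> last q = v \<and> q ! l = z}"
    have "{q \<in> extend (good i). hd q = u \<and> last q = v} \<subseteq> (\<Union>(l, z)\<in>{1..i} \<times> F. ?S l z)"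
    proof
      fix q assume q: "q \<in> {q \<in> extend (good i). hd q = u \<and> last q = v}"
      then have len: "length q = Suc (Suc i)"
        using extend_good_props(1) by blast
      from q none obtain z where z: "z \<in> set q" "z \<in> F" "z \<noteq> u" "z \<noteq> v"
        by blast
      then obtain l where l: "l < length q" "q ! l = z"
        by (auto simp: in_set_conv_nth)
      have "q \<noteq> []" using len by auto
      then have "q ! 0 = u" "q ! Suc i = v"
        using q len by (auto simp: hd_conv_nth last_conv_nth)
      then have "l \<noteq> 0" "l \<noteq> Suc i"
        using l z by metis+
      then have "l \<in> {1..i}"
        using l(1) len by auto
      then show "q \<in> (\<Union>(l, z)\<in>{1..i} \<times> F. ?S l z)"
        using q l z by auto
    qed
    then have "card {q \<in> extend (good i). hd q = u \<and> last q = v} \<le> card (\<Union>(l, z)\<in>{1..i} \<times> F. ?S l z)"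
      using F finite_extend_good by (intro card_mono) auto
    also have "\<dots> \<le> (\<Sum>(l, z)\<in>{1..i} \<times> F. card (?S l z))"
      using card_UN_le[of "{1..i} \<times> F" "\<lambda>(l, z). ?S l z"] F by (simp add: case_prod_unfold)
    also have "\<dots> \<le> (\<Sum>(l, z)\<in>{1..i} \<times> F. (cap k t i)\<^sup>2)"
      by (intro sum_mono) (auto intro!: card_extend_through)
    also have "\<dots> = (i * card F) * (cap k t i)\<^sup>2"
      by (simp add: case_prod_unfold card_cartesian_product)
    also have "\<dots> \<le> (Suc i * (2 * spread k t + 2)) * (cap k t i)\<^sup>2"
      using F by (intro mult_le_mono) auto
    also have "\<dots> = cap k t (Suc i)"
      by (simp add: algebra_simps)
    finally show False
      using big by simp
  qed
  then show thesis
    using that by blast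
qed

lemma inj_on_snoc: "inj_on (\<lambda>(p, v). p @ [v]) A"
  by (auto simp: inj_on_def)

lemma card_good_from_le:
  assumes "x \<in> V"
  shows "card {p \<in> good i. hd p = x} \<le> d ^ i"
proof (induction i)
  case 0
  have "{p \<in> good 0. hd p = x} \<subseteq> {[x]}"
    by auto
  then have "card {p \<in> good 0. hd p = x} \<le> card {[x]}"
    by (intro card_mono) auto
  then show ?case by simp
next
  case (Suc i)
  let ?S = "SIGMA p:{p \<in> good i. hd p = x}. D (last p)"
  have "{p \<in> good (Suc i). hd p = x} \<subseteq> (\<lambda>(p, v). p @ [v]) ` ?S"
  proof
    fix q assume "q \<in> {p \<in> good (Suc i). hd p = x}"
    then have q: "q \<in> extend (good i)" "hd q = x"
      by auto
    note p = extend_good_props[OF q(1)]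
    have ne: "butlast q \<noteq> []"
      using p(1) by (auto simp flip: length_0_conv)
    then have "hd (butlast q) = x"
      using q(2) p(7) by (metis hd_append2)
    moreover have "successively arc (butlast q @ [last q])"
      using p(3,7) by simp
    then have "last q \<in> D (last (butlast q))"
      using ne by (simp add: successively_append_iff)
    ultimately have "(butlast q, last q) \<in> ?S"
      using p by auto
    then show "q \<in> (\<lambda>(p, v). p @ [v]) ` ?S"
      using p(7) by force
  qed
  moreover have fin: "finite ?S"
    using finite_good finite_D[OF last_V] by (intro finite_SigmaI) auto
  ultimately have "card {p \<in> good (Suc i). hd p = x} \<le> card ?S"
    using surj_card_le by blast
  also have "\<dots> = (\<Sum>p\<in>{p \<in> good i. hd p = x}. card (D (last p)))"
    using finite_good finite_D[OF last_V] by (intro card_SigmaI) auto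
  also have "\<dots> = card {p \<in> good i. hd p = x} * d"
  proof -
    have "card (D (last p)) = d" if "p \<in> good i" for p
      using card_D[OF last_V[OF that]] .
    then show ?thesis by simp
  qed
  also have "\<dots> \<le> d ^ i * d"
    using Suc by simp
  finally show ?case by (simp add: mult.commute)
qed

section \<open>Bad paths from a fixed vertex\<close>

lemma adj_sym: "adj u v \<longleftrightarrow> adj v u"
  by (auto simp: adj_def)

text \<open>A path with one edge is determined by its ends. This removes the case in which the last
  edge of a bad path from \<open>x\<close> starts in \<open>x\<close>.\<close>

lemma bad_0: "bad 0 = {}"
proof -
  have "card {q \<in> extend (good 0). hd q = u \<and> last q = v} \<le> cap k t 1" for u v
  proof -
    have "{q \<in> extend (good 0). hd q = u \<and> last q = v} \<subseteq> {[u, v]}"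
    proof clarify
      fix q assume "q \<in> extend (good 0)"
      then have "length q = Suc (Suc 0)"
        by (rule extend_good_props)
      then show "q = [hd q, last q]"
        by (auto simp: length_Suc_conv)
    qed
    then have "card {q \<in> extend (good 0). hd q = u \<and> last q = v} \<le> card {[u, v]}"
      by (intro card_mono) auto
    also have "\<dots> \<le> cap k t 1"
      using cap_ge_1[of k t 1] by simp
    finally show ?thesis .
  qed
  then show ?thesis
    by (auto simp: bad_def simp del: cap.simps)
qed

text \<open>The path \<open>p\<close> leads towards the common vertex \<open>z\<close> and is
  traversed backwards, which the symmetry of \<open>adj\<close> permits; \<open>tl\<close> drops the
  second occurrence of \<open>z\<close>.\<close>

lemma join_paths:
  assumes q: "path_between adj i x z q" and p: "path_between adj l y z p"
    and disj: "set q \<inter> set p \<subseteq> {z}"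
  shows "path_between adj (i + l) x y (q @ tl (rev p))"
proof -
  have p': "p \<noteq> []" "length p = Suc l" "distinct p" "successively adj p" "hd p = y" "last p = z"
    using p by (auto simp: path_between_def)
  have q': "q \<noteq> []" "length q = Suc i" "distinct q" "successively adj q" "hd q = x" "last q = z"
    using q by (auto simp: path_between_def)
  define r where "r = tl (rev p)"
  have rev: "rev p = z # r"
    using p' by (metis hd_rev list.collapse r_def rev_is_Nil_conv)
  have r: "distinct (z # r)" "successively adj (z # r)" "set r \<subseteq> set p" "last (z # r) = y"
  proof -
    show "distinct (z # r)"
      using p'(3) by (metis distinct_rev rev)
    have "successively (\<lambda>u v. adj v u) p"
      using p'(4) by (rule successively_mono) (simp add: adj_sym)
    then have "successively adj (rev p)"
      by (simp add: successively_rev)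
    then show "successively adj (z # r)"
      by (simp add: rev)
    have "set (rev p) = insert z (set r)"
      by (simp add: rev)
    then show "set r \<subseteq> set p" by auto
    show "last (z # r) = y"
      using p' rev last_rev[of p] by simp
  qed
  have len: "length r = l"
    using p'(2) by (simp add: r_def)
  have "distinct (q @ r)"
    using q' r disj by auto
  moreover have "successively adj (q @ r)"
    using q' r by (auto simp: successively_append_iff successively_Cons)
  moreover have "hd (q @ r) = x" "last (q @ r) = y"
    using q' r by (auto split: if_splits)
  ultimately show ?thesis
    using len q' by (simp add: path_between_def r_def)
qed

text \<open>
  If there were more, the last edges of the bad paths from \<open>x\<close> would form a dense bipartite graph
  \<open>\<Gamma>\<close>.  Its dense core contains paths of length \<open>k - Suc i\<close> from a fixed \<open>y\<close> to vertices \<open>z\<close>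
  joined to \<open>x\<close> by so many paths of length \<open>Suc i\<close> that one of these avoids any given small set.
  Repeating this yields a theta graph with ends \<open>x\<close> and \<open>y\<close>.
\<close>

lemma card_bad_from_le:
  assumes no_theta: "\<not> has_theta k t adj" and i: "Suc i \<le> k" and x: "x \<in> V"
  shows "card {p \<in> bad i. hd p = x} \<le> 2 * spread k t * cap k t i * d ^ i"
proof (cases "i = 0")
  case True
  then show ?thesis by (simp add: bad_0)
next
  case False
  let ?s = "spread k t"
  let ?B = "{p \<in> bad i. hd p = x}"
  let ?e = "\<lambda>p. (last (butlast p), last p)"
  define \<Gamma> where "\<Gamma> = ?e ` ?B"
  define W where "W = fst ` \<Gamma>"
  define R where "R = snd ` \<Gamma>"
  have finB: "finite ?B"
    using finite_extend_good[of i] by (auto simp: bad_def)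
  then have fin: "finite \<Gamma>" "finite W" "finite R"
    by (auto simp: \<Gamma>_def W_def R_def)
  have B: "p \<in> extend (good i)" "hd (butlast p) = x" "butlast p \<in> good i" "p = butlast p @ [last p]"
    "distinct p" "last (butlast p) \<noteq> x" "last p \<noteq> x" "last p \<in> D (last (butlast p))"
    if "p \<in> ?B" for p
  proof -
    show p: "p \<in> extend (good i)"
      using that by (simp add: bad_def)
    note pp = extend_good_props[OF p]
    show "butlast p \<in> good i" "p = butlast p @ [last p]" "distinct p"
      using pp by auto
    define b where "b = butlast p"
    define v where "v = last p"
    have pbv: "p = b @ [v]"
      using pp(7) by (simp add: b_def v_def)
    have "length b = Suc i"
      using pp(1) by (simp add: b_def)
    then obtain a b' where b: "b = a # b'" "b' \<noteq> []"
      using False by (cases b) auto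
    then have "a = x"
      using that pbv by auto
    then show "hd (butlast p) = x" "last (butlast p) \<noteq> x" "last p \<noteq> x"
      using pp(2) b unfolding pbv by auto
    show "last p \<in> D (last (butlast p))"
      using pp(3) b unfolding pbv by (auto simp: successively_append_iff successively_Cons)
  qed
  \<comment> \<open>A bad path amounts to its last vertex and a good path from \<open>x\<close> to
    \<open>w\<close>, so few bad paths share a last edge.\<close>
  have fibre: "card {p \<in> ?B. last (butlast p) = w \<and> last p = v} \<le> cap k t i" for w v
  proof -
    have "card {p \<in> ?B. last (butlast p) = w \<and> last p = v} \<le> card {q \<in> good i. hd q = x \<and> last q = w}"
    proof (rule card_inj_on_le[of butlast])
      show "inj_on butlast {p \<in> ?B. last (butlast p) = w \<and> last p = v}"
      proof (rule inj_onI)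
        fix p q assume pq: "p \<in> {p \<in> ?B. last (butlast p) = w \<and> last p = v}"
          "q \<in> {p \<in> ?B. last (butlast p) = w \<and> last p = v}" and eq: "butlast p = butlast q"
        then have "p \<in> ?B" "q \<in> ?B" "last p = last q"
          by simp_all
        then show "p = q"
          using B(4) eq by metis
      qed
      show "butlast ` {p \<in> ?B. last (butlast p) = w \<and> last p = v} \<subseteq> {q \<in> good i. hd q = x \<and> last q = w}"
        using B(2,3) by auto
    qed (use finite_good in auto)
    then show ?thesis
      using card_good_between order_trans by blast
  qed
  show ?thesis
  proof (rule ccontr)
    assume "\<not> ?thesis"
    then have big: "2 * ?s * cap k t i * d ^ i < card ?B" by simp
    also have "\<dots> \<le> cap k t i * card \<Gamma>"
      unfolding \<Gamma>_def using finB fibre by (intro card_le_fibres) (auto simp: conj_assoc)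
    finally have "cap k t i * (2 * ?s * d ^ i) < cap k t i * card \<Gamma>"
      by (simp add: algebra_simps)
    then have 1: "2 * ?s * d ^ i < card \<Gamma>"
      by simp
    \<comment> \<open>The vertices of \<open>W\<close> are ends of good paths with \<open>i\<close>
      edges. The analogous bound for \<open>R\<close> would be \<open>d ^ Suc i\<close>, which is
      too weak; degrees in \<Gamma> are used there instead.\<close>
    have "W \<subseteq> last ` {p \<in> good i. hd p = x}"
      using B(2,3) by (auto simp: W_def \<Gamma>_def)
    then have "card W \<le> card (last ` {p \<in> good i. hd p = x})"
      using finite_good by (intro card_mono) auto
    also have "\<dots> \<le> card {p \<in> good i. hd p = x}"
      using finite_good by (intro card_image_le) auto
    also have "\<dots> \<le> d ^ i"
      using card_good_from_le[OF x] .
    finally have "2 * ?s * card W \<le> 2 * ?s * d ^ i"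
      by simp
    with 1 have cW: "2 * ?s * card W < card \<Gamma>" by linarith
    \<comment> \<open>Whether a member of \<open>extend (good i)\<close> is bad depends only on its
      ends, so one bad path to \<open>v\<close> makes all of them bad.\<close>
    have ends: "card {q \<in> extend (good i). hd q = x \<and> last q = v} > cap k t (Suc i)"
      and in_B: "{q \<in> extend (good i). hd q = x \<and> last q = v} \<subseteq> ?B" if v: "v \<in> R" for v
    proof -
      obtain p where p: "p \<in> bad i" "hd p = x" "last p = v"
        using v by (auto simp: R_def \<Gamma>_def)
      then show *: "card {q \<in> extend (good i). hd q = x \<and> last q = v} > cap k t (Suc i)"
        by (auto simp: bad_def simp del: cap.simps)
      then show "{q \<in> extend (good i). hd q = x \<and> last q = v} \<subseteq> ?B"
        by (auto simp: bad_def simp del: cap.simps)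
    qed
    have deg: "2 * ?s \<le> card {g \<in> \<Gamma>. snd g = v}" if v: "v \<in> R" for v
    proof -
      let ?Q = "{q \<in> extend (good i). hd q = x \<and> last q = v}"
      have finQ: "finite ?Q" using finite_extend_good by simp
      have "cap k t (Suc i) < card ?Q"
        using ends[OF v] .
      also have "\<dots> \<le> cap k t i * card (?e ` ?Q)"
      proof (rule card_le_fibres[OF finQ])
        fix g assume "g \<in> ?e ` ?Q"
        have "card {q \<in> ?Q. ?e q = g} \<le> card {p \<in> ?B. last (butlast p) = fst g \<and> last p = snd g}"
          using in_B[OF v] by (intro card_mono rev_finite_subset[OF finB]) auto
        then show "card {q \<in> ?Q. ?e q = g} \<le> cap k t i"
          using fibre order_trans by blast
      qed
      also have "card (?e ` ?Q) \<le> card {g \<in> \<Gamma>. snd g = v}"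
        using in_B[OF v] fin by (intro card_mono) (auto simp: \<Gamma>_def)
      finally have "cap k t i * ((2 * ?s + 2) * Suc i * cap k t i) < cap k t i * card {g \<in> \<Gamma>. snd g = v}"
        by (simp add: power2_eq_square algebra_simps)
      then have "(2 * ?s + 2) * Suc i * cap k t i < card {g \<in> \<Gamma>. snd g = v}"
        by (simp only: mult_less_cancel1)
      moreover have "(2 * ?s + 2) * 1 * 1 \<le> (2 * ?s + 2) * Suc i * cap k t i"
        using cap_ge_1[of k t i] by (intro mult_le_mono) auto
      ultimately have "(2 * ?s + 2) * 1 * 1 < card {g \<in> \<Gamma>. snd g = v}"
        using le_less_trans by blast
      then show ?thesis by simp
    qed
    have cR: "2 * ?s * card R \<le> card \<Gamma>"
      unfolding R_def using fin(1) by (rule card_ge_fibres) (use deg in \<open>simp add: R_def\<close>)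
    \<comment> \<open>Half of the edges of \<Gamma> pay for \<open>W\<close>, the other half for
      \<open>R\<close>.\<close>
    have dense: "card \<Gamma> > ?s * (card W + card R)"
      using cW cR by (simp add: algebra_simps)
    have "\<Gamma> \<subseteq> W \<times> R"
      by (force simp: W_def R_def)
    then obtain W' R' where WR: "W' \<subseteq> W" "R' \<subseteq> R" "W' \<noteq> {}" "R' \<noteq> {}"
      "\<forall>w\<in>W'. card {v \<in> R'. (w, v) \<in> \<Gamma>} > ?s" "\<forall>v\<in>R'. card {w \<in> W'. (w, v) \<in> \<Gamma>} > ?s"
      by (elim exE conjE min_degree_subrelation[OF fin(2,3) _ dense, elim_format])
    \<comment> \<open>Layer 0 is \<open>R'\<close>, so that the connecting path ends in a vertex
      rich with \<open>x\<close> whatever the parity of \<open>k - Suc i\<close>.\<close>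
    define Z where "Z l = (if even l then R' else W')" for l :: nat
    have finWR: "finite W'" "finite R'"
      using WR fin by (auto intro: finite_subset)
    have \<Gamma>_adj: "adj w v" "adj v w" if "(w, v) \<in> \<Gamma>" for w v
      using that B(8) by (auto simp: adj_def \<Gamma>_def)
    have Z_deg: "card {z \<in> Z l. adj y z} > ?s" if "y \<in> Z (Suc l)" for l y
    proof (cases "even l")
      case True
      then have "card {v \<in> R'. (y, v) \<in> \<Gamma>} \<le> card {z \<in> Z l. adj y z}"
        using \<Gamma>_adj finWR by (intro card_mono) (auto simp: Z_def)
      moreover have "?s < card {v \<in> R'. (y, v) \<in> \<Gamma>}"
        using WR(5) that True by (auto simp: Z_def)
      ultimately show ?thesis by simp
    next
      case False
      then have "card {w \<in> W'. (w, y) \<in> \<Gamma>} \<le> card {z \<in> Z l. adj y z}"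
        using \<Gamma>_adj finWR by (intro card_mono) (auto simp: Z_def)
      moreover have "?s < card {w \<in> W'. (w, y) \<in> \<Gamma>}"
        using WR(6) that False by (auto simp: Z_def)
      ultimately show ?thesis by simp
    qed
    \<comment> \<open>Keeps the connecting path away from \<open>x\<close>, where every path to be
      attached to it begins.\<close>
    have x_notin: "x \<notin> \<Union> (range Z)"
    proof -
      have "W = (\<lambda>p. last (butlast p)) ` ?B" "R = last ` ?B"
        by (simp_all add: W_def R_def \<Gamma>_def image_image)
      then have "x \<notin> W" "x \<notin> R"
        using B(6,7) by (metis (no_types, lifting) imageE)+
      then show ?thesis
        using WR(1,2) by (auto simp: Z_def split: if_splits)
    qed
    have "Z (k - Suc i) \<noteq> {}"
      using WR(3,4) by (simp add: Z_def)
    then obtain y where y: "y \<in> Z (k - Suc i)"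
      by blast
    have "has_theta k t adj"
    proof (rule has_theta_greedy)
      fix F :: "'a set" assume F: "finite F" "card F \<le> t * Suc k"
      have "card F + (k - Suc i) \<le> ?s"
        using F by (simp add: spread_def)
      from path_in_layers[where Z = Z and adj = adj, OF Z_deg F(1) this y]
      obtain p z where p: "z \<in> R'" "path_between adj (k - Suc i) y z p"
        "set (tl p) \<inter> F = {}" "set p \<subseteq> \<Union> (range Z)"
        by (auto simp: Z_def)
      have "card (set p) \<le> k"
        using p(2) i card_length[of p] by (simp add: path_between_def)
      then have "card (F \<union> set p) \<le> 2 * ?s + 1"
        using F card_Un_le[of F "set p"] by (simp add: spread_def)
      moreover have "z \<in> R"
        using p(1) WR(2) by auto
      ultimately obtain q where q: "q \<in> extend (good i)" "hd q = x" "last q = z"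
        "set q \<inter> (F \<union> set p) \<subseteq> {x, z}"
        using extend_avoiding[of "F \<union> set p" i x z, OF _ _ ends] F(1) by blast
      have "successively adj q"
        using extend_good_props(3)[OF q(1)] by (rule successively_mono) (simp add: adj_def)
      then have "path_between adj (Suc i) x z q"
        using extend_good_props(1,2)[OF q(1)] q by (simp add: path_between_def)
      moreover have "set q \<inter> set p \<subseteq> {z}"
        using q(4) p(4) x_notin by auto
      ultimately have "path_between adj (Suc i + (k - Suc i)) x y (q @ tl (rev p))"
        using p(2) join_paths by blast
      moreover have "set (q @ tl (rev p)) \<inter> F \<subseteq> {x, y}"
      proof -
        have pne: "p \<noteq> []" "hd p = y" "last p = z"
          using p(2) by (auto simp: path_between_def)
        then have sp: "set p = insert y (set (tl p))"
          by (cases p) auto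
        have "set (tl (rev p)) \<subseteq> set p"
          using set_drop_subset[of 1 "rev p"] by (simp add: drop_Suc)
        moreover have "z \<in> set p"
          using pne by auto
        ultimately show ?thesis
          using q(4) p(3) sp by auto
      qed
      moreover have "Suc i + (k - Suc i) = k"
        using i by simp
      ultimately show "\<exists>p. path_between adj k x y p \<and> set p \<inter> F \<subseteq> {x, y}"
        by metis
    qed
    with no_theta show False ..
  qed
qed

section \<open>Lower bound for the number of good paths\<close>

lemma snoc_good_cases:
  assumes p: "p \<in> good i" and v: "v \<in> D (last p)" "v \<notin> set p"
  shows "p @ [v] \<in> good (Suc i) \<or> (\<exists>l\<le>i. drop (i - l) (p @ [v]) \<in> bad l)"
proof (rule disjCI)
  assume no_bad: "\<not> (\<exists>l\<le>i. drop (i - l) (p @ [v]) \<in> bad l)"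
  let ?q = "p @ [v]"
  have len: "length p = Suc i" and dist: "distinct p" "successively arc p"
    using good_length_set[OF p] good_distinct[OF p] by auto
  have q: "distinct ?q" "successively arc ?q"
    using dist v len by (auto simp: successively_append_iff)
  have "v \<in> V"
    using v(1) D_subset[OF last_V[OF p]] by auto
  \<comment> \<open>Suffixes are treated by increasing length. The next longer one has a good
    \<open>tl\<close> by induction and a good \<open>butlast\<close> as a subpath of
    \<open>p\<close>, so it can fail to be good only by being bad.\<close>
  have "drop (Suc i - l) ?q \<in> good l" if "l \<le> Suc i" for l
    using that
  proof (induction l)
    case 0
    then show ?case using len \<open>v \<in> V\<close> by simp
  next
    case (Suc l)
    let ?r = "drop (i - l) ?q"
    have drop_p: "?r = drop (i - l) p @ [v]"
      using len by simp
    have "tl ?r = drop (Suc (i - l)) ?q"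
      by (simp only: drop_Suc tl_drop)
    also have "Suc (i - l) = Suc i - l"
      using Suc.prems by simp
    finally have 1: "tl ?r \<in> good l"
      using Suc.IH Suc.prems by (metis Suc_leD)
    have 2: "butlast ?r \<in> good l"
      unfolding drop_p using good_drop[OF p, of "i - l"] Suc.prems by simp
    have "?q = take (i - l) ?q @ ?r"
      by (rule append_take_drop_id[symmetric])
    then have "successively arc (take (i - l) ?q @ ?r)"
      using q(2) by (rule subst)
    then have 3: "successively arc ?r"
      unfolding successively_append_iff by blast
    have "?r \<in> extend (good l)"
      using 1 2 3 distinct_drop[OF q(1)] unfolding extend_def by blast
    then show ?case
      using no_bad Suc.prems by (auto simp: bad_def)
  qed
  from this[of "Suc i"] show "?q \<in> good (Suc i)"
    by simp
qed

text \<open>A continuation of a good path fails if it returns to one of its \<open>Suc i\<close>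
  vertices or creates a bad suffix. In the second case it consists of a good path with
  \<open>i - l\<close> edges and a bad path in \<open>bad l\<close> from its end, so
  \<open>card_bad_from_le\<close> allows a constant times \<open>d ^ (i - l) * d ^ l\<close> of
  these: one factor \<open>d\<close> below the main term.\<close>

lemma card_good_from_step:
  assumes no_theta: "\<not> has_theta k t adj" and i: "Suc i \<le> k" and x: "x \<in> V"
  shows "d * card {p \<in> good i. hd p = x}
    \<le> card {p \<in> good (Suc i). hd p = x} + Suc i * loss k t * d ^ i"
proof -
  let ?g = "\<lambda>i. {p \<in> good i. hd p = x}"
  let ?C = "2 * spread k t * cap k t k"
  let ?f = "\<lambda>(p, v). p @ [v :: 'a]"
  let ?S = "SIGMA p:?g i. D (last p)"
  let ?N = "?f ` (SIGMA p:?g i. set p)"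
  \<comment> \<open>The two pieces share the vertex at position \<open>i - l\<close>.\<close>
  let ?J = "\<lambda>l. {q. take (Suc (i - l)) q \<in> ?g (i - l) \<and> drop (i - l) q \<in> bad l}"
  have fin_g: "finite (?g j)" for j
    using finite_good by simp
  have finS: "finite ?S"
    using fin_g finite_D[OF last_V] by (intro finite_SigmaI) auto
  have finN: "finite ?N"
    using fin_g by (intro finite_imageI finite_SigmaI) auto
  have fin_bad: "finite (bad l)" for l
    using finite_extend_good by (simp add: bad_def)
  have J: "finite (?J l) \<and> card (?J l) \<le> ?C * d ^ i" if l: "l \<le> i" for l
  proof -
    let ?P = "SIGMA p:?g (i - l). {b \<in> bad l. hd b = last p}"
    let ?h = "\<lambda>q. (take (Suc (i - l)) q, drop (i - l) q)"
    have inj: "inj_on ?h (?J l)"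
    proof (rule inj_onI)
      fix p q assume eq: "?h p = ?h q"
      have "drop (Suc (i - l)) p = drop (Suc (i - l)) q"
        using eq by (simp add: drop_Suc drop_tl)
      then show "p = q"
        using eq append_take_drop_id[of "Suc (i - l)"] by (metis prod.inject)
    qed
    have sub: "?h ` ?J l \<subseteq> ?P"
    proof (rule image_subsetI)
      fix q assume q: "q \<in> ?J l"
      then have "drop (i - l) q \<in> extend (good l)"
        by (simp add: bad_def)
      then have "length (drop (i - l) q) = Suc (Suc l)"
        by (rule extend_good_props)
      then have "i - l < length q"
        by simp
      then have "hd (drop (i - l) q) = last (take (Suc (i - l)) q)"
        by (simp add: hd_drop_conv_nth take_Suc_conv_app_nth)
      then show "?h q \<in> ?P"
        using q by simp
    qed
    have finP: "finite ?P"
      using fin_g fin_bad by (intro finite_SigmaI) auto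
    have "card (?J l) \<le> card ?P"
      using inj sub finP by (rule card_inj_on_le)
    also have "\<dots> = (\<Sum>p\<in>?g (i - l). card {b \<in> bad l. hd b = last p})"
      using fin_g fin_bad by (intro card_SigmaI) auto
    also have "\<dots> \<le> (\<Sum>p\<in>?g (i - l). ?C * d ^ l)"
    proof (rule sum_mono)
      fix p assume "p \<in> ?g (i - l)"
      then have "last p \<in> V"
        using last_V by blast
      then have "card {b \<in> bad l. hd b = last p} \<le> 2 * spread k t * cap k t l * d ^ l"
        using no_theta l i by (intro card_bad_from_le) auto
      also have "\<dots> \<le> ?C * d ^ l"
        using l i by (intro mult_le_mono cap_mono) auto
      finally show "card {b \<in> bad l. hd b = last p} \<le> ?C * d ^ l" .
    qed
    also have "\<dots> = card (?g (i - l)) * (?C * d ^ l)"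
      by simp
    also have "\<dots> \<le> d ^ (i - l) * (?C * d ^ l)"
      using card_good_from_le[OF x] by (intro mult_le_mono) auto
    also have "\<dots> = ?C * (d ^ (i - l) * d ^ l)"
      by (simp only: ac_simps)
    also have "\<dots> = ?C * d ^ i"
      using l by (simp flip: power_add)
    finally show ?thesis
      using finite_imageD[OF finite_subset[OF sub finP] inj] by blast
  qed
  have fin_J: "finite (\<Union>l\<in>{..i}. ?J l)"
    using J by (intro finite_UN_I) simp_all
  have sub: "?f ` ?S \<subseteq> ?g (Suc i) \<union> (?N \<union> (\<Union>l\<in>{..i}. ?J l))"
  proof
    fix q assume "q \<in> ?f ` ?S"
    then obtain p v where q: "q = p @ [v]" and p: "p \<in> good i" "hd p = x" and v: "v \<in> D (last p)"
      by auto
    have len: "length p = Suc i"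
      using good_length_set[OF p(1)] by simp
    show "q \<in> ?g (Suc i) \<union> (?N \<union> (\<Union>l\<in>{..i}. ?J l))"
    proof (cases "v \<in> set p")
      case True
      then have "q \<in> ?N"
        using p q by force
      then show ?thesis by blast
    next
      case False
      have hdq: "hd q = x"
        using p len q by (cases p) auto
      from snoc_good_cases[OF p(1) v False] show ?thesis
      proof
        assume "p @ [v] \<in> good (Suc i)"
        then show ?thesis using hdq q by blast
      next
        assume "\<exists>l\<le>i. drop (i - l) (p @ [v]) \<in> bad l"
        then obtain l where l: "l \<le> i" "drop (i - l) q \<in> bad l"
          using q by blast
        have "take (Suc (i - l)) q = take (Suc (i - l)) p"
          using len q by simp
        moreover have "take (Suc (i - l)) p \<in> good (i - l)"
          using good_take[OF p(1)] by simp
        moreover have "hd (take (Suc (i - l)) p) = x"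
          using p by (simp add: hd_take)
        ultimately have "take (Suc (i - l)) q \<in> ?g (i - l)"
          by (simp only: mem_Collect_eq)
        then have "q \<in> ?J l"
          using l(2) by blast
        then show ?thesis using l by blast
      qed
    qed
  qed
  have "card (?f ` ?S) \<le> card (?g (Suc i) \<union> (?N \<union> (\<Union>l\<in>{..i}. ?J l)))"
    by (rule card_mono[OF finite_UnI[OF fin_g finite_UnI[OF finN fin_J]] sub])
  also have "\<dots> \<le> card (?g (Suc i)) + (card ?N + card (\<Union>l\<in>{..i}. ?J l))"
    by (rule order_trans[OF card_Un_le add_left_mono[OF card_Un_le]])
  also have "card (\<Union>l\<in>{..i}. ?J l) \<le> (\<Sum>l\<in>{..i}. card (?J l))"
    by (rule card_UN_le) simp
  also have "\<dots> \<le> (\<Sum>l\<in>{..i}. ?C * d ^ i)"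
    using J by (intro sum_mono) auto
  also have "\<dots> = Suc i * (?C * d ^ i)"
    by simp
  also have "card ?N \<le> card (SIGMA p:?g i. set p)"
    using fin_g by (intro card_image_le finite_SigmaI) auto
  also have "\<dots> = (\<Sum>p\<in>?g i. card (set p))"
    using fin_g by (intro card_SigmaI) auto
  also have "\<dots> \<le> (\<Sum>p\<in>?g i. Suc i)"
  proof (rule sum_mono)
    fix p assume "p \<in> ?g i"
    then have "length p = Suc i"
      using good_length_set by simp
    then show "card (set p) \<le> Suc i"
      using card_length[of p] by simp
  qed
  also have "\<dots> = card (?g i) * Suc i"
    by simp
  also have "\<dots> \<le> d ^ i * Suc i"
    using card_good_from_le[OF x] by (intro mult_le_mono) auto
  finally have "card (?f ` ?S) \<le> card (?g (Suc i)) + Suc i * loss k t * d ^ i"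
    by (simp add: loss_def algebra_simps)
  moreover have "card (?f ` ?S) = d * card (?g i)"
  proof -
    have "card (?f ` ?S) = card ?S"
      by (rule card_image[OF inj_on_snoc])
    also have "\<dots> = (\<Sum>p\<in>?g i. card (D (last p)))"
      using fin_g finite_D[OF last_V] by (intro card_SigmaI) auto
    also have "\<dots> = (\<Sum>p\<in>?g i. d)"
      using card_D[OF last_V] by (intro sum.cong) auto
    finally show ?thesis by (simp add: mult.commute)
  qed
  ultimately show ?thesis by simp
qed

text \<open>Good paths of length \<open>k\<close> from one vertex are counted in two ways: up to
  lower order at least \<open>d ^ k\<close>, and at most \<open>cap k t k\<close> for each end. The
  second summand of the constant covers small \<open>d\<close>, where the lower bound is
  void.\<close>

lemma power_le_card_if_no_theta:
  assumes no_theta: "\<not> has_theta k t adj" and "V \<noteq> {}"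
  shows "d ^ k \<le> (2 * cap k t k + (2 * k\<^sup>2 * loss k t) ^ k) * card V"
proof -
  obtain x where x: "x \<in> V" using assms(2) by blast
  let ?g = "\<lambda>i. card {p \<in> good i. hd p = x}"
  let ?L = "loss k t"
  \<comment> \<open>The error accumulated over the steps is of order d^(i - 1); the extra factor
    \<open>d\<close> on both sides avoids this exponent, which is negative for
    \<open>i = 0\<close>.\<close>
  have lower: "d ^ Suc i \<le> d * ?g i + i * k * ?L * d ^ i" if "i \<le> k" for i
    using that
  proof (induction i)
    case 0
    have "{p \<in> good 0. hd p = x} = {[x]}"
      using x by auto
    then have "?g 0 = 1"
      by (simp only: card.empty card.insert) simp
    then show ?case by simp
  next
    case (Suc i)
    then have "d ^ Suc (Suc i) \<le> d * (d * ?g i + i * k * ?L * d ^ i)"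
      unfolding power_Suc[of d "Suc i"] by (intro mult_le_mono2) simp
    also have "\<dots> \<le> d * ((?g (Suc i) + Suc i * ?L * d ^ i) + i * k * ?L * d ^ i)"
      using card_good_from_step[OF no_theta Suc.prems x] by (intro mult_le_mono2 add_le_mono1)
    also have "\<dots> = d * ?g (Suc i) + (Suc i + i * k) * (?L * d ^ Suc i)"
      by (simp add: algebra_simps)
    also have "\<dots> \<le> d * ?g (Suc i) + (Suc i * k) * (?L * d ^ Suc i)"
      using Suc.prems by (intro add_left_mono mult_le_mono1) simp
    finally show ?case
      by (simp only: mult.assoc)
  qed
  have "?g k \<le> card V * cap k t k"
  proof -
    have "?g k \<le> card (\<Union>v\<in>V. {q \<in> good k. hd q = x \<and> last q = v})"
      using finite_good finite_V last_V by (intro card_mono) auto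
    also have "\<dots> \<le> (\<Sum>v\<in>V. card {q \<in> good k. hd q = x \<and> last q = v})"
      by (rule card_UN_le[OF finite_V])
    also have "\<dots> \<le> (\<Sum>v\<in>V. cap k t k)"
      by (intro sum_mono card_good_between)
    finally show ?thesis by simp
  qed
  have V1: "1 \<le> card V"
    using assms(2) finite_V by (simp add: Suc_le_eq card_gt_0_iff)
  show ?thesis
  proof (cases "d \<le> 2 * k\<^sup>2 * ?L")
    case True
    then have "d ^ k \<le> (2 * k\<^sup>2 * ?L) ^ k * 1"
      by (simp add: power_mono)
    also have "\<dots> \<le> (2 * cap k t k + (2 * k\<^sup>2 * ?L) ^ k) * card V"
      using V1 by (intro mult_le_mono) auto
    finally show ?thesis .
  next
    case False
    have "2 * d ^ Suc k \<le> 2 * d * ?g k + (2 * k\<^sup>2 * ?L) * d ^ k"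
      using lower[of k] by (simp add: power2_eq_square algebra_simps)
    also have "\<dots> \<le> 2 * d * ?g k + d * d ^ k"
      using False by (intro add_left_mono mult_le_mono1) simp
    finally have "d * d ^ k \<le> d * (2 * ?g k)"
      by simp
    then have "d ^ k \<le> 2 * ?g k"
      using False by simp
    also have "\<dots> \<le> (2 * cap k t k) * card V"
      using \<open>?g k \<le> _\<close> by (simp add: mult.commute)
    also have "\<dots> \<le> (2 * cap k t k + (2 * k\<^sup>2 * ?L) ^ k) * card V"
      by simp
    finally show ?thesis .
  qed
qed

end

lemma has_theta_mono:
  assumes "has_theta k t adj" "\<And>u v. adj u v \<Longrightarrow> adj' u v"
  shows "has_theta k t adj'"
proof -
  obtain f where "inj_on f (fst (theta_graph k t))"
    "\<forall>i<t. \<forall>j<k. adj (f (path_vertex k i j)) (f (path_vertex k i (Suc j)))"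
    using assms(1) unfolding has_theta_def by (elim exE conjE)
  then have "inj_on f (fst (theta_graph k t)) \<and>
      (\<forall>i<t. \<forall>j<k. adj' (f (path_vertex k i j)) (f (path_vertex k i (Suc j))))"
    using assms(2) by simp
  then show ?thesis
    unfolding has_theta_def by (rule exI[of _ f])
qed

text \<open>For m = \<open>card P + card Q\<close> and \<open>d\<close> a large multiple of m^(1/k)
  the hypotheses ask for the usual order m^(1 + 1/k) of edges; a free integer \<open>d\<close>
  avoids real powers. A core of minimum degree above \<open>d\<close> gives each vertex
  \<open>d\<close> neighbours to select.\<close>

lemma faudree_simonovits:
  fixes k t :: nat
  obtains A :: nat where "A \<ge> 1" and
    "\<And>(E :: ('a \<times> 'a) set) P Q d. \<lbrakk>finite P; finite Q; P \<inter> Q = {}; E \<subseteq> P \<times> Q;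
       card E > d * (card P + card Q); d ^ k > A * (card P + card Q)\<rbrakk> \<Longrightarrow>
       has_theta k t (\<lambda>u v. (u, v) \<in> E \<or> (v, u) \<in> E)"
proof
  define A where "A = 2 * cap k t k + (2 * k\<^sup>2 * loss k t) ^ k"
  show "A \<ge> 1"
    using cap_ge_1[of k t k] by (simp add: A_def)
  fix E :: "('a \<times> 'a) set" and P Q d
  assume PQ: "finite P" "finite Q" "P \<inter> Q = {}" "E \<subseteq> P \<times> Q"
    and E: "card E > d * (card P + card Q)" and d: "d ^ k > A * (card P + card Q)"
  obtain P' Q' where sub: "P' \<subseteq> P" "Q' \<subseteq> Q" "P' \<noteq> {}" "Q' \<noteq> {}"
    and deg: "\<forall>p\<in>P'. card {q \<in> Q'. (p, q) \<in> E} > d" "\<forall>q\<in>Q'. card {p \<in> P'. (p, q) \<in> E} > d"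
    using min_degree_subrelation[OF PQ(1,2,4) E] by (elim exE conjE)
  have finPQ: "finite (P' \<union> Q')"
    using finite_subset[OF sub(1) PQ(1)] finite_subset[OF sub(2) PQ(2)] by simp
  have "\<exists>D. D \<subseteq> {v \<in> P' \<union> Q'. (u, v) \<in> E \<or> (v, u) \<in> E} \<and> card D = d"
    if "u \<in> P' \<union> Q'" for u
  proof -
    have fin: "finite {v \<in> P' \<union> Q'. (u, v) \<in> E \<or> (v, u) \<in> E}"
      using finPQ by simp
    have "d \<le> card {v \<in> P' \<union> Q'. (u, v) \<in> E \<or> (v, u) \<in> E}"
    proof (cases "u \<in> P'")
      case True
      then have "d < card {q \<in> Q'. (u, q) \<in> E}"
        by (rule bspec[OF deg(1)])
      also have "\<dots> \<le> card {v \<in> P' \<union> Q'. (u, v) \<in> E \<or> (v, u) \<in> E}"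
        by (intro card_mono fin) auto
      finally show ?thesis by simp
    next
      case False
      then have "u \<in> Q'"
        using that by simp
      then have "d < card {p \<in> P'. (p, u) \<in> E}"
        by (rule bspec[OF deg(2)])
      also have "\<dots> \<le> card {v \<in> P' \<union> Q'. (u, v) \<in> E \<or> (v, u) \<in> E}"
        by (intro card_mono fin) auto
      finally show ?thesis by simp
    qed
    then obtain D where "D \<subseteq> {v \<in> P' \<union> Q'. (u, v) \<in> E \<or> (v, u) \<in> E}" "card D = d"
      by (rule obtain_subset_with_card_n)
    then show ?thesis by blast
  qed
  then have "\<exists>D. \<forall>u\<in>P' \<union> Q'.
      D u \<subseteq> {v \<in> P' \<union> Q'. (u, v) \<in> E \<or> (v, u) \<in> E} \<and> card (D u) = d"
    by (intro bchoice ballI)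
  then obtain D where D: "\<And>u. u \<in> P' \<union> Q' \<Longrightarrow>
      D u \<subseteq> {v \<in> P' \<union> Q'. (u, v) \<in> E \<or> (v, u) \<in> E} \<and> card (D u) = d"
    by blast
  \<comment> \<open>Outside \<open>P' \<union> Q'\<close> the choice must be empty, as \<open>adj\<close> is not restricted to it.\<close>
  define D' where "D' u = (if u \<in> P' \<union> Q' then D u else {})" for u
  interpret out_regular "P' \<union> Q'" D' d k t
  proof
    show "finite (P' \<union> Q')"
      by (rule finPQ)
  next
    fix u assume "u \<in> P' \<union> Q'"
    then show "D' u \<subseteq> P' \<union> Q'" "card (D' u) = d"
      using D[of u] by (auto simp: D'_def)
  qed
  have "has_theta k t adj"
  proof (rule ccontr)
    assume "\<not> has_theta k t adj"
    then have "d ^ k \<le> A * card (P' \<union> Q')"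
      unfolding A_def using sub by (intro power_le_card_if_no_theta) auto
    also have "\<dots> \<le> A * (card P + card Q)"
    proof (rule mult_le_mono2)
      have "card (P' \<union> Q') \<le> card P' + card Q'"
        by (rule card_Un_le)
      also have "\<dots> \<le> card P + card Q"
        using sub PQ by (intro add_mono card_mono)
      finally show "card (P' \<union> Q') \<le> card P + card Q" .
    qed
    finally show False
      using d by simp
  qed
  then show "has_theta k t (\<lambda>u v. (u, v) \<in> E \<or> (v, u) \<in> E)"
  proof (rule has_theta_mono)
    fix u v assume "adj u v"
    then show "(u, v) \<in> E \<or> (v, u) \<in> E"
      using D[of u] D[of v] by (auto simp: adj_def D'_def split: if_splits)
  qed
qed

section \<open>Reduction to neighbourhoods of an edge\<close>

text \<open>Only endpoints of edges are vertices, so that containing a copy is monotone in the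
  relation alone.\<close>

definition edge_graph :: "('a \<times> 'a) set \<Rightarrow> 'a graph" where
  "edge_graph E = (Field E, {{u, v} |u v. (u, v) \<in> E})"

lemma contains_copy_edge_graph_mono:
  assumes "contains_copy (edge_graph E) H" "E \<subseteq> E'"
  shows "contains_copy (edge_graph E') H"
proof -
  obtain f where "inj_on f (fst H)" "f ` fst H \<subseteq> Field E"
    "\<forall>e\<in>snd H. f ` e \<in> {{u, v} |u v. (u, v) \<in> E}"
    using assms(1) by (auto simp: contains_copy_def edge_graph_def)
  moreover have "Field E \<subseteq> Field E'"
    using assms(2) by (rule mono_Field)
  moreover have "{{u, v} |u v. (u, v) \<in> E} \<subseteq> {{u, v} |u v. (u, v) \<in> E'}"
    using assms(2) by blast
  ultimately show ?thesis
    unfolding contains_copy_def edge_graph_def fst_conv snd_conv by (meson order_trans subsetD)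
qed

lemma E_plus_copy_if_theta:
  assumes disj: "P \<inter> Q = {}" and E: "E \<subseteq> P \<times> Q" and xy: "(x, y) \<in> E"
    and P': "\<And>p. p \<in> P' \<Longrightarrow> (p, y) \<in> E \<and> p \<noteq> x" and Q': "\<And>q. q \<in> Q' \<Longrightarrow> (x, q) \<in> E \<and> q \<noteq> y"
    and E': "E' \<subseteq> E \<inter> P' \<times> Q'"
    and theta: "has_theta k t (\<lambda>u v. (u, v) \<in> E' \<or> (v, u) \<in> E')"
    and kt: "1 \<le> k" "1 \<le> t"
  shows "contains_copy (edge_graph E) (E_plus_graph k t)"
proof -
  let ?A = "\<lambda>u v. (u, v) \<in> E' \<or> (v, u) \<in> E'"
  obtain f where inj: "inj_on f (fst (theta_graph k t))"
    and f: "\<forall>i<t. \<forall>j<k. ?A (f (path_vertex k i j)) (f (path_vertex k i (Suc j)))"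
    using theta unfolding has_theta_def by blast
  have PQ': "P' \<subseteq> P" "Q' \<subseteq> Q" "P' \<inter> Q' = {}"
    using P' Q' E disj by blast+
  have A_side: "u \<in> P' \<and> v \<in> Q' \<or> u \<in> Q' \<and> v \<in> P'" if "?A u v" for u v
    using that E' by blast
  \<comment> \<open>If \<open>Source\<close> lies in \<open>P'\<close>, so does all of
    \<open>theta_A k t\<close>. Since \<open>P'\<close> consists of neighbours of \<open>y\<close>,
    the vertex \<open>X\<close> is then sent to \<open>y\<close>, and otherwise to
    \<open>x\<close>.\<close>
  define s where "s \<longleftrightarrow> f Source \<in> P'"
  have side: "f (path_vertex k i j) \<in> (if even j \<longleftrightarrow> s then P' else Q')" if "i < t" "j \<le> k" for i j
    using that(2)
  proof (induction j)
    case 0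
    have "?A (f (path_vertex k i 0)) (f (path_vertex k i (Suc 0)))"
      using f that(1) kt by (metis less_le_trans less_one)
    then show ?case
      using A_side by (auto simp: path_vertex_def s_def)
  next
    case (Suc j)
    then have "?A (f (path_vertex k i j)) (f (path_vertex k i (Suc j)))"
      using f that(1) by simp
    from A_side[OF this] show ?case
      using Suc PQ'(3) by (auto split: if_splits)
  qed
  have sideA: "f v \<in> (if s then P' else Q')" if "v \<in> theta_A k t" for v
    using that side by (fastforce simp: theta_A_def)
  have sideB: "f v \<in> (if s then Q' else P')" if "v \<in> theta_B k t" for v
    using that side by (fastforce simp: theta_B_def)
  have fst_theta: "fst (theta_graph k t) = theta_A k t \<union> theta_B k t"
    using theta_bipartition[of k t] by (auto simp: bipartition_def)
  define g where "g w = (case w of Theta v \<Rightarrow> f v | X \<Rightarrow> if s then y else x | Y \<Rightarrow> if s then x else y)" for w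
  have g: "g (Theta v) = f v" "g X = (if s then y else x)" "g Y = (if s then x else y)" for v
    by (simp_all add: g_def)
  have xyPQ: "x \<in> P" "y \<in> Q" "x \<noteq> y"
    using xy E disj by auto
  have f_ne: "f v \<noteq> x" "f v \<noteq> y" "f v \<in> Field E" if "v \<in> fst (theta_graph k t)" for v
  proof -
    have "f v \<in> P' \<union> Q'"
      using that sideA[of v] sideB[of v] unfolding fst_theta by (auto split: if_splits)
    then show "f v \<noteq> x" "f v \<noteq> y" "f v \<in> Field E"
      using P' Q' PQ' xyPQ disj by (auto intro: FieldI1 FieldI2)
  qed
  have fst_E: "fst (E_plus_graph k t) = Theta ` fst (theta_graph k t) \<union> {X, Y}"
    by (simp add: E_plus_graph_def E_graph_def)
  have "inj_on g (fst (E_plus_graph k t))"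
  proof (rule inj_onI)
    fix u v assume "u \<in> fst (E_plus_graph k t)" "v \<in> fst (E_plus_graph k t)" "g u = g v"
    then show "u = v"
      using inj f_ne xyPQ(3) unfolding fst_E
      by (cases u; cases v) (auto simp: g inj_on_def split: if_splits)
  qed
  moreover have "g ` fst (E_plus_graph k t) \<subseteq> Field E"
    using f_ne(3) xy unfolding fst_E by (auto simp: g intro: FieldI1 FieldI2)
  moreover have "\<forall>e\<in>snd (E_plus_graph k t). g ` e \<in> {{u, v} |u v. (u, v) \<in> E}"
  proof
    have edge: "{u, v} \<in> {{u, v} |u v. (u, v) \<in> E}" if "(u, v) \<in> E \<or> (v, u) \<in> E" for u v
      using that by (auto simp: insert_commute)
    fix e assume "e \<in> snd (E_plus_graph k t)"
    then consider "e = {X, Y}" | d where "d \<in> snd (theta_graph k t)" "e = Theta ` d"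
      | a where "a \<in> theta_A k t" "e = {X, Theta a}" | b where "b \<in> theta_B k t" "e = {Y, Theta b}"
      unfolding E_plus_graph_def E_graph_def snd_conv by blast
    then show "g ` e \<in> {{u, v} |u v. (u, v) \<in> E}"
    proof cases
      case 1
      then show ?thesis
        using edge[of x y] edge[of y x] xy by (simp add: g)
    next
      case 2
      then obtain i j where "i < t" "j < k" "d = {path_vertex k i j, path_vertex k i (Suc j)}"
        unfolding theta_graph_def by auto
      then have "g ` e = {f (path_vertex k i j), f (path_vertex k i (Suc j))}"
        "?A (f (path_vertex k i j)) (f (path_vertex k i (Suc j)))"
        using 2 f by (simp_all add: g)
      then show ?thesis
        using edge[of "f (path_vertex k i j)" "f (path_vertex k i (Suc j))"] E' by auto
    next
      case 3
      have "g ` e = {g X, f a}"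
        using 3 by (simp add: g)
      moreover have "(g X, f a) \<in> E \<or> (f a, g X) \<in> E"
        using sideA[OF 3(1)] P' Q' by (auto simp: g split: if_splits)
      ultimately show ?thesis
        using edge by simp
    next
      case 4
      have "g ` e = {g Y, f b}"
        using 4 by (simp add: g)
      moreover have "(g Y, f b) \<in> E \<or> (f b, g Y) \<in> E"
        using sideB[OF 4(1)] P' Q' by (auto simp: g split: if_splits)
      ultimately show ?thesis
        using edge by simp
    qed
  qed
  ultimately show ?thesis
    unfolding contains_copy_def edge_graph_def fst_conv snd_conv by blast
qed

section \<open>Four-cycles through an edge\<close>

lemma four_cycle_count:
  fixes E :: "('a \<times> 'b) set" and n :: nat
  assumes fin: "finite P" "finite Q" and E: "E \<subseteq> P \<times> Q" and n: "card P \<le> n" "card Q \<le> n"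
  shows "real (card E) ^ 4 \<le> real n ^ 4 *
    (\<Sum>(x, y)\<in>E. real (card {(x', y'). (x', y') \<in> E \<and> (x', y) \<in> E \<and> (x, y') \<in> E}))"
proof -
  define a :: "'a \<Rightarrow> 'b \<Rightarrow> real" where "a p q = of_bool ((p, q) \<in> E)" for p q
  \<comment> \<open>\<open>c\<close> is the codegree, \<open>S\<close> counts walks of length two
    between vertices of \<open>P\<close>, and \<open>T\<close> counts closed walks of length four,
    degenerate ones included. Cauchy-Schwarz is applied twice: to the degrees over \<open>Q\<close>
    and to the codegrees over \<open>P \<times> P\<close>.\<close>
  define c where "c p p' = (\<Sum>q\<in>Q. a p q * a p' q)" for p p'
  define S where "S = (\<Sum>p\<in>P. \<Sum>p'\<in>P. c p p')"
  define T where "T = (\<Sum>p\<in>P. \<Sum>p'\<in>P. (c p p')\<^sup>2)"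
  have finE: "finite E"
    using E fin by (rule_tac finite_subset) auto
  have sumE: "(\<Sum>(x, y)\<in>E. h x y) = (\<Sum>x\<in>P. \<Sum>y\<in>Q. a x y * h x y)" for h :: "'a \<Rightarrow> 'b \<Rightarrow> real"
  proof -
    have "(\<Sum>x\<in>P. \<Sum>y\<in>Q. a x y * h x y) = (\<Sum>(x, y)\<in>P \<times> Q. a x y * h x y)"
      by (rule sum.cartesian_product)
    also have "\<dots> = (\<Sum>(x, y)\<in>E. h x y)"
      using fin E by (intro sum.mono_neutral_cong_right) (auto simp: a_def)
    finally show ?thesis ..
  qed
  have cardE: "real (card E) = (\<Sum>q\<in>Q. \<Sum>p\<in>P. a p q)"
    using sumE[of "\<lambda>_ _. 1"] by (simp add: sum.swap[of _ P Q])
  have ES: "(real (card E))\<^sup>2 \<le> real n * S"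
  proof -
    have "(real (card E))\<^sup>2 \<le> (\<Sum>q\<in>Q. (\<Sum>p\<in>P. a p q)\<^sup>2) * card Q"
      unfolding cardE by (rule sum_squared_le_sum_of_squares)
    also have "(\<Sum>q\<in>Q. (\<Sum>p\<in>P. a p q)\<^sup>2) = S"
      unfolding S_def c_def power2_eq_square sum_product
      by (simp add: sum.swap[of _ Q P])
    finally have "(real (card E))\<^sup>2 \<le> S * card Q" .
    also have "\<dots> \<le> S * real n"
      using n by (intro mult_left_mono) (auto simp: S_def c_def a_def intro!: sum_nonneg)
    finally show ?thesis by (simp add: mult.commute)
  qed
  have ST: "S\<^sup>2 \<le> (real n)\<^sup>2 * T"
  proof -
    have "S\<^sup>2 \<le> (\<Sum>(p, p')\<in>P \<times> P. (c p p')\<^sup>2) * card (P \<times> P)"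
      using sum_squared_le_sum_of_squares[of "\<lambda>(p, p'). c p p'" "P \<times> P"]
      by (simp add: S_def sum.cartesian_product case_prod_unfold)
    also have "(\<Sum>(p, p')\<in>P \<times> P. (c p p')\<^sup>2) = T"
      by (simp add: T_def sum.cartesian_product)
    also have "T * card (P \<times> P) \<le> T * (real n)\<^sup>2"
      using n by (intro mult_left_mono)
        (auto simp: T_def card_cartesian_product power2_eq_square intro!: sum_nonneg mult_mono)
    finally show ?thesis by (simp add: mult.commute)
  qed
  have T: "T = (\<Sum>(x, y)\<in>E. real (card {(x', y'). (x', y') \<in> E \<and> (x', y) \<in> E \<and> (x, y') \<in> E}))"
  proof -
    have inner: "real (card {(x', y'). (x', y') \<in> E \<and> (x', y) \<in> E \<and> (x, y') \<in> E})
        = (\<Sum>x'\<in>P. \<Sum>y'\<in>Q. a x' y' * (a x' y * a x y'))" for x y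
    proof -
      have "(\<Sum>(x', y')\<in>E. a x' y * a x y')
          = (\<Sum>z\<in>{(x', y'). (x', y') \<in> E \<and> (x', y) \<in> E \<and> (x, y') \<in> E}. 1)"
        using finE by (intro sum.mono_neutral_cong_right) (auto simp: a_def)
      then show ?thesis
        using sumE[of "\<lambda>x' y'. a x' y * a x y'"] by simp
    qed
    have "T = (\<Sum>x\<in>P. \<Sum>x'\<in>P. \<Sum>y\<in>Q. \<Sum>y'\<in>Q. a x y * (a x' y' * (a x' y * a x y')))"
      unfolding T_def c_def power2_eq_square sum_product by (intro sum.cong) auto
    also have "\<dots> = (\<Sum>x\<in>P. \<Sum>y\<in>Q. a x y * (\<Sum>x'\<in>P. \<Sum>y'\<in>Q. a x' y' * (a x' y * a x y')))"
      unfolding sum_distrib_left by (intro sum.cong refl sum.swap)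
    also have "\<dots> = (\<Sum>(x, y)\<in>E. real (card {(x', y'). (x', y') \<in> E \<and> (x', y) \<in> E \<and> (x, y') \<in> E}))"
      unfolding inner by (rule sumE[symmetric])
    finally show ?thesis .
  qed
  have "real (card E) ^ 4 = ((real (card E))\<^sup>2)\<^sup>2"
    by (simp flip: power_mult)
  also have "\<dots> \<le> (real n * S)\<^sup>2"
    using ES by (intro power_mono) auto
  also have "\<dots> = (real n)\<^sup>2 * S\<^sup>2"
    by (simp add: power_mult_distrib)
  also have "\<dots> \<le> (real n)\<^sup>2 * ((real n)\<^sup>2 * T)"
    using ST by (intro mult_left_mono) auto
  also have "\<dots> = real n ^ 4 * T"
    by (simp add: power2_eq_square power4_eq_xxxx)
  finally show ?thesis
    unfolding T .
qed

text \<open>Averaging of \<open>four_cycle_count\<close> over the edges.\<close>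

lemma edge_in_many_four_cycles:
  fixes E :: "('a \<times> 'b) set" and n :: nat
  assumes fin: "finite P" "finite Q" and E: "E \<subseteq> P \<times> Q" and n: "card P \<le> n" "card Q \<le> n"
    and ne: "E \<noteq> {}"
  shows "\<exists>x y. (x, y) \<in> E \<and>
    real (card E) ^ 3 \<le> real n ^ 4 * real (card {(x', y'). (x', y') \<in> E \<and> (x', y) \<in> E \<and> (x, y') \<in> E})"
proof -
  let ?h = "\<lambda>z. real (card {(x', y'). (x', y') \<in> E \<and> (x', snd z) \<in> E \<and> (fst z, y') \<in> E})"
  have finE: "finite E"
    using E fin by (rule_tac finite_subset) auto
  have "\<exists>z\<in>E. real (card E) ^ 3 \<le> real n ^ 4 * ?h z"
  proof (rule ccontr)
    assume "\<not> ?thesis"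
    then have "(\<Sum>z\<in>E. real n ^ 4 * ?h z) < (\<Sum>z\<in>E. real (card E) ^ 3)"
      using ne finE by (intro sum_strict_mono) auto
    then have "real n ^ 4 * (\<Sum>z\<in>E. ?h z) < real (card E) ^ 4"
      by (simp add: sum_distrib_left power3_eq_cube power4_eq_xxxx)
    moreover have "real (card E) ^ 4 \<le> real n ^ 4 * (\<Sum>z\<in>E. ?h z)"
      using four_cycle_count[OF fin E n] by (simp add: case_prod_unfold)
    ultimately show False by simp
  qed
  then show ?thesis
    by fastforce
qed

text \<open>The degree bound is \<open>L\<close> times the average degree with respect to
  \<open>n\<close>. The property \<open>F\<close> stays abstract because regularization relies on
  its monotonicity only.\<close>

definition regular_forces :: "(('a \<times> 'a) set \<Rightarrow> bool) \<Rightarrow> real \<Rightarrow> real \<Rightarrow> real \<Rightarrow> bool" where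
  "regular_forces F L a C \<longleftrightarrow> (\<forall>E P Q n. finite P \<and> finite Q \<and> P \<inter> Q = {} \<and> E \<subseteq> P \<times> Q \<and>
     card P \<le> n \<and> card Q \<le> n \<and> 0 < n \<and>
     (\<forall>p. real (card {q. (p, q) \<in> E}) \<le> L * card E / n) \<and>
     (\<forall>q. real (card {p. (p, q) \<in> E}) \<le> L * card E / n) \<and>
     C * real n powr a \<le> card E \<longrightarrow> F E)"

lemma regular_case:
  fixes k t :: nat and L :: real
  assumes k: "2 \<le> k" and t: "1 \<le> t" and L: "0 < L"
  obtains C :: real where "0 < C"
    "regular_forces (\<lambda>E :: ('a \<times> 'a) set. contains_copy (edge_graph E) (E_plus_graph k t))
       L ((3 * real k - 1) / (2 * real k - 1)) C"
proof -
  obtain A :: nat where A: "A \<ge> 1" and FS: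
    "\<And>(E :: ('a \<times> 'a) set) P Q d. \<lbrakk>finite P; finite Q; P \<inter> Q = {}; E \<subseteq> P \<times> Q;
       card E > d * (card P + card Q); d ^ k > A * (card P + card Q)\<rbrakk> \<Longrightarrow>
       has_theta k t (\<lambda>u v. (u, v) \<in> E \<or> (v, u) \<in> E)"
    using faudree_simonovits[of k t] by blast
  \<comment> \<open>The summand \<open>4 * L\<close> makes the degenerate four-cycles less than half
    of those found, the last one serves the second hypothesis of the theta bound, and 1 ensures that
    \<open>C\<close> is at most its own powers.\<close>
  define C where "C = 1 + 4 * L + A * (2 * L) * (8 * L) ^ k"
  have C: "1 \<le> C" "4 * L < C" "A * (2 * L) * (8 * L) ^ k < C"
    using L by (auto simp: C_def add_nonneg_pos add_pos_nonneg)
  show thesis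
  proof (rule that)
    show "0 < C" using C by simp
    show "regular_forces (\<lambda>E :: ('a \<times> 'a) set. contains_copy (edge_graph E) (E_plus_graph k t))
       L ((3 * real k - 1) / (2 * real k - 1)) C"
      unfolding regular_forces_def
    proof (intro allI impI, elim conjE)
      fix E :: "('a \<times> 'a) set" and P Q :: "'a set" and n :: nat
      assume fin: "finite P" "finite Q" and disj: "P \<inter> Q = {}" and E: "E \<subseteq> P \<times> Q"
        and n: "card P \<le> n" "card Q \<le> n" "0 < n"
        and degP: "\<forall>p. real (card {q. (p, q) \<in> E}) \<le> L * card E / n"
        and degQ: "\<forall>q. real (card {p. (p, q) \<in> E}) \<le> L * card E / n"
        and big: "C * real n powr ((3 * real k - 1) / (2 * real k - 1)) \<le> card E"
      define N where "N = real n"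
      define d where "d = card E / N"
      have N: "1 \<le> N" using n by (simp add: N_def)
      have Ed: "real (card E) = d * N"
        using N by (simp add: d_def)
      have k1: "2 * real k - 1 > 0" using k by simp
      let ?b = "real k / (2 * real k - 1)"
      have "(3 * real k - 1) / (2 * real k - 1) = ?b + 1"
        using k1 by (simp add: field_simps)
      then have "C * N powr ?b * N \<le> d * N"
        using big N unfolding Ed N_def[symmetric] by (simp add: powr_add)
      then have d_ge: "C * N powr ?b \<le> d"
        using N by simp
      have powr_pos: "0 < N powr ?b" using N by simp
      have d_pos: "0 < d"
        using d_ge C powr_pos by (smt (verit) mult_pos_pos)
      \<comment> \<open>The threshold on \<open>d\<close> with the root cleared; this is the form in
        which it meets the condition on \<open>\<delta> ^ k\<close>.\<close>
      have d_pow: "C * N ^ k \<le> d ^ (2 * k - 1)"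
      proof -
        have "(N powr ?b) ^ (2 * k - 1) = N powr (?b * (2 * real k - 1))"
          using N k by (simp add: powr_powr of_nat_diff flip: powr_realpow)
        also have "\<dots> = N ^ k"
          using N k1 by (simp add: powr_realpow)
        finally have Nk: "N ^ k = (N powr ?b) ^ (2 * k - 1)" ..
        have "C * N ^ k \<le> C ^ (2 * k - 1) * N ^ k"
          using C N k by (intro mult_right_mono self_le_power) auto
        also have "\<dots> = (C * N powr ?b) ^ (2 * k - 1)"
          by (simp add: power_mult_distrib Nk)
        also have "\<dots> \<le> d ^ (2 * k - 1)"
          using d_ge C by (intro power_mono) auto
        finally show ?thesis .
      qed
      have d_sq: "4 * L * N < d\<^sup>2"
      proof -
        have "1 \<le> 2 * ?b"
          using k1 by (simp add: field_simps)
        then have "N powr 1 \<le> N powr (2 * ?b)"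
          using N by (intro powr_mono) auto
        then have "N \<le> (N powr ?b)\<^sup>2"
          using N by (simp add: powr_powr mult.commute flip: powr_realpow)
        then have "C * N \<le> C * (N powr ?b)\<^sup>2"
          using C by (intro mult_left_mono) auto
        also have "\<dots> \<le> C\<^sup>2 * (N powr ?b)\<^sup>2"
          using C by (intro mult_right_mono self_le_power) auto
        also have "\<dots> = (C * N powr ?b)\<^sup>2"
          by (simp add: power_mult_distrib)
        also have "\<dots> \<le> d\<^sup>2"
          using d_ge C by (intro power_mono) auto
        finally have "C * N \<le> d\<^sup>2" .
        moreover have "4 * L * N < C * N"
          using C N by (intro mult_strict_right_mono) auto
        ultimately show ?thesis by simp
      qed
      have finE: "finite E"
        using E fin by (rule_tac finite_subset) auto
      have "E \<noteq> {}"
        using d_pos by (auto simp: d_def)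
      then obtain x y where xy: "(x, y) \<in> E"
        and cyc: "real (card E) ^ 3 \<le> N ^ 4 * real (card {(x', y'). (x', y') \<in> E \<and> (x', y) \<in> E \<and> (x, y') \<in> E})"
        using edge_in_many_four_cycles[OF fin E n(1,2)] unfolding N_def by blast
      define P' where "P' = {p. (p, y) \<in> E} - {x}"
      define Q' where "Q' = {q. (x, q) \<in> E} - {y}"
      define E' where "E' = E \<inter> P' \<times> Q'"
      let ?F = "{(x', y'). (x', y') \<in> E \<and> (x', y) \<in> E \<and> (x, y') \<in> E}"
      have finN: "finite {p. (p, v) \<in> E}" "finite {q. (v, q) \<in> E}" for v
      proof -
        have "{p. (p, v) \<in> E} \<subseteq> fst ` E" "{q. (v, q) \<in> E} \<subseteq> snd ` E"
          by force+
        then show "finite {p. (p, v) \<in> E}" "finite {q. (v, q) \<in> E}"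
          using finE by (simp_all add: finite_subset)
      qed
      have fin': "finite P'" "finite Q'"
        using finN by (simp_all add: P'_def Q'_def)
      have deg_N: "real (card {p. (p, v) \<in> E}) \<le> L * d" "real (card {q. (v, q) \<in> E}) \<le> L * d" for v
        using degP degQ by (simp_all add: d_def N_def)
      have cardPQ: "real (card P' + card Q') \<le> 2 * L * d"
      proof -
        have "card P' \<le> card {p. (p, y) \<in> E}" "card Q' \<le> card {q. (x, q) \<in> E}"
          using finN by (auto simp: P'_def Q'_def intro!: card_mono)
        then show ?thesis
          using deg_N(1)[of y] deg_N(2)[of x] by linarith
      qed
      \<comment> \<open>Pairs in \<open>?F\<close> with \<open>x' = x\<close> or
        \<open>y' = y\<close> are edges at \<open>x\<close> or \<open>y\<close>, at most
        \<open>2 * L * d\<close> in number; all others lie in \<open>E'\<close>.\<close>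
      have cardE': "d ^ 3 / N - 2 * L * d \<le> card E'"
      proof -
        have "?F \<subseteq> E' \<union> (Pair x ` {q. (x, q) \<in> E} \<union> (\<lambda>p. (p, y)) ` {p. (p, y) \<in> E})"
          by (auto simp: E'_def P'_def Q'_def)
        then have "card ?F \<le> card (E' \<union> (Pair x ` {q. (x, q) \<in> E} \<union> (\<lambda>p. (p, y)) ` {p. (p, y) \<in> E}))"
          using finN finE by (intro card_mono) (auto simp: E'_def)
        also have "\<dots> \<le> card E' + (card (Pair x ` {q. (x, q) \<in> E}) + card ((\<lambda>p. (p, y)) ` {p. (p, y) \<in> E}))"
          by (rule order_trans[OF card_Un_le add_left_mono[OF card_Un_le]])
        also have "\<dots> \<le> card E' + (card {q. (x, q) \<in> E} + card {p. (p, y) \<in> E})"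
          using finN by (intro add_mono card_image_le) auto
        finally have "real (card ?F) \<le> card E' + 2 * L * d"
          using deg_N(1)[of y] deg_N(2)[of x] by linarith
        moreover have "d ^ 3 / N \<le> card ?F"
        proof -
          have "N ^ 4 * (d ^ 3 / N) = real (card E) ^ 3"
            using N unfolding Ed by (simp add: power_mult_distrib power3_eq_cube power4_eq_xxxx)
          also have "\<dots> \<le> N ^ 4 * card ?F"
            by (rule cyc)
          finally show ?thesis
            by (rule mult_left_le_imp_le) (use N in simp)
        qed
        ultimately show ?thesis by linarith
      qed
      \<comment> \<open>The quotient of d^3/(2N), which \<open>card E'\<close> exceeds, by the bound
        \<open>2 * L * d\<close> on \<open>card P' + card Q'\<close>. As it is greater than 1,
        rounding down costs at most a factor of two.\<close>
      define z where "z = d\<^sup>2 / (4 * L * N)"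
      define \<delta> where "\<delta> = nat \<lfloor>z\<rfloor>"
      have z: "1 < z"
        using d_sq L N by (simp add: z_def)
      have \<delta>: "real \<delta> \<le> z" "z / 2 \<le> real \<delta>"
      proof -
        have "0 \<le> \<lfloor>z\<rfloor>" "1 \<le> \<lfloor>z\<rfloor>" using z by simp_all
        then have "real \<delta> = of_int \<lfloor>z\<rfloor>" "1 \<le> real_of_int \<lfloor>z\<rfloor>" by (simp_all add: \<delta>_def)
        then show "real \<delta> \<le> z" "z / 2 \<le> real \<delta>"
          using floor_correct[of z] by linarith+
      qed
      have "real (\<delta> * (card P' + card Q')) < real (card E')"
      proof -
        have "real (\<delta> * (card P' + card Q')) \<le> z * (2 * L * d)"
          unfolding of_nat_mult using \<delta> cardPQ z by (intro mult_mono) auto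
        also have "\<dots> = d ^ 3 / (2 * N)"
          using L N by (simp add: z_def field_simps power2_eq_square power3_eq_cube)
        also have "\<dots> < d ^ 3 / N - 2 * L * d"
        proof -
          have "d * (4 * L * N) < d * d\<^sup>2"
            using d_sq d_pos by (rule mult_strict_left_mono)
          then have "4 * L * d * N < d ^ 3"
            by (simp add: power2_eq_square power3_eq_cube algebra_simps)
          then show ?thesis
            using N by (simp add: field_simps)
        qed
        finally show ?thesis
          using cardE' by linarith
      qed
      then have c1: "\<delta> * (card P' + card Q') < card E'"
        by (simp only: of_nat_less_iff)
      have "real (A * (card P' + card Q')) < real (\<delta> ^ k)"
      proof -
        have "real (A * (card P' + card Q')) \<le> A * (2 * L * d)"
          unfolding of_nat_mult using cardPQ by (intro mult_left_mono) auto
        also have "\<dots> < (z / 2) ^ k"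
        proof -
          have "(A * (2 * L * d)) * ((8 * L) ^ k * N ^ k) = (A * (2 * L) * (8 * L) ^ k) * (d * N ^ k)"
            by (simp only: ac_simps)
          also have "\<dots> < C * (d * N ^ k)"
            using C d_pos N by (intro mult_strict_right_mono) auto
          also have "\<dots> = d * (C * N ^ k)"
            by simp
          also have "\<dots> \<le> d * d ^ (2 * k - 1)"
            using d_pow d_pos by (intro mult_left_mono) auto
          also have "\<dots> = d ^ (2 * k)"
            using k by (simp flip: power_Suc)
          also have "\<dots> = (z / 2) ^ k * ((8 * L) ^ k * N ^ k)"
          proof -
            have "z / 2 * (8 * L * N) = d\<^sup>2"
              using L N by (simp add: z_def)
            then have "d ^ (2 * k) = (z / 2 * (8 * L * N)) ^ k"
              by (simp add: power_mult)
            then show ?thesis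
              by (simp only: power_mult_distrib)
          qed
          finally show ?thesis
            using L N by (simp add: mult_less_cancel_right)
        qed
        also have "\<dots> \<le> real \<delta> ^ k"
          using \<delta> z by (intro power_mono) auto
        finally show ?thesis by simp
      qed
      then have c2: "A * (card P' + card Q') < \<delta> ^ k"
        by (simp only: of_nat_less_iff)
      have "P' \<inter> Q' = {}"
        using E disj by (auto simp: P'_def Q'_def)
      then have "has_theta k t (\<lambda>u v. (u, v) \<in> E' \<or> (v, u) \<in> E')"
        using FS[OF fin' _ _ c1 c2] by (auto simp: E'_def)
      then show "contains_copy (edge_graph E) (E_plus_graph k t)"
        using k t by (intro E_plus_copy_if_theta[OF disj E xy, of P' Q' E'])
          (auto simp: P'_def Q'_def E'_def)
    qed
  qed
qed

section \<open>Regularization\<close>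

text \<open>Up to \<open>m\<close> elements are split off at a time; \<open>r\<close> such blocks
  exhaust \<open>Q\<close>.\<close>

lemma subadditive_blocks:
  fixes g :: "'a set \<Rightarrow> real"
  assumes "finite Q" "card Q \<le> r * m"
    and "g {} \<le> 0" and sub: "\<And>A B. \<lbrakk>A \<subseteq> Q; B \<subseteq> Q\<rbrakk> \<Longrightarrow> g (A \<union> B) \<le> g A + g B"
    and le: "\<And>A. \<lbrakk>A \<subseteq> Q; card A \<le> m\<rbrakk> \<Longrightarrow> g A \<le> c" and "0 \<le> c"
  shows "g Q \<le> r * c"
proof -
  have "g R \<le> r * c" if "R \<subseteq> Q" "card R \<le> r * m" for R
    using that
  proof (induction r arbitrary: R)
    case 0
    then have "R = {}"
      using finite_subset[OF _ assms(1)] by auto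
    then show ?case using assms(3) by simp
  next
    case (Suc r)
    have "min m (card R) \<le> card R" by simp
    then obtain S where S: "S \<subseteq> R" "card S = min m (card R)"
      by (rule obtain_subset_with_card_n)
    have "finite S"
      using finite_subset[OF order_trans[OF S(1) Suc.prems(1)] assms(1)] .
    then have "card (R - S) = card R - card S"
      using S(1) by (rule card_Diff_subset)
    also have "\<dots> \<le> r * m"
      using S(2) Suc.prems(2) by (auto simp: min_def)
    finally have "g (R - S) \<le> r * c"
      using Suc by blast
    moreover have "g S \<le> c"
      using S Suc.prems(1) by (intro le) auto
    moreover have "g ((R - S) \<union> S) \<le> g (R - S) + g S"
      using S Suc.prems(1) by (intro sub) auto
    moreover have "(R - S) \<union> S = R"
      using S by blast
    ultimately show ?case
      by (simp add: algebra_simps)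
  qed
  then show ?thesis
    using assms(2) by blast
qed

text \<open>The degrees, with \<open>f\<close> later \<open>fst\<close> or \<open>snd\<close>, add
  up to \<open>card E\<close>, so at most \<open>m\<close> of them exceed \<open>card E / m\<close>.
  The inclusion makes the set of these vertices finite.\<close>

lemma high_degree:
  assumes "finite E" "0 < m" "E \<noteq> {}"
  shows "{v. card E / m < card {e \<in> E. f e = v}} \<subseteq> f ` E" (is "?S \<subseteq> _")
    and "card {v. card E / m < card {e \<in> E. f e = v}} \<le> m"
proof -
  show S: "?S \<subseteq> f ` E"
  proof (rule ccontr)
    assume "\<not> ?thesis"
    then obtain v where v: "card E / m < card {e \<in> E. f e = v}" "v \<notin> f ` E"
      by blast
    from v(2) have "{e \<in> E. f e = v} = {}"
      by auto
    with v(1) show False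
      by (simp only: card.empty) (simp add: field_simps assms)
  qed
  have "card ?S * (card E / m) = (\<Sum>v\<in>?S. card E / m)"
    by simp
  also have "\<dots> \<le> (\<Sum>v\<in>?S. real (card {e \<in> E. f e = v}))"
    by (intro sum_mono) auto
  also have "\<dots> \<le> (\<Sum>v\<in>f ` E. real (card {e \<in> E. f e = v}))"
    using S assms by (intro sum_mono2) auto
  also have "\<dots> = real (card E)"
    by (simp flip: of_nat_sum card_eq_sum_fibres[OF assms(1), of f])
  finally have "real (card ?S) * card E \<le> real m * card E"
    using assms by (simp add: field_simps)
  then show "card ?S \<le> m"
    using assms by (simp add: card_gt_0_iff)
qed

text \<open>
  Induction on \<open>n\<close>: the edges at the at most \<open>n div K\<close> vertices of highest degree on each side are
  covered by \<open>2 * K\<close> blocks of size \<open>n div K\<close>, to which the induction hypothesis applies; as \<open>a > 1\<close>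
  these are at most half of all edges, and the remaining edges have bounded maximum degree.
\<close>

lemma regularization:
  fixes F :: "('a \<times> 'a) set \<Rightarrow> bool" and a C :: real and K :: nat
  assumes a: "1 < a" and K: "2 \<le> K" "8 \<le> real K powr (a - 1)" and C: "0 < C"
    and mono: "\<And>E E'. \<lbrakk>F E; E \<subseteq> E'\<rbrakk> \<Longrightarrow> F E'"
    and reg: "regular_forces F (4 * real K) a C"
    and PQ: "finite P" "finite Q" "P \<inter> Q = {}" "E \<subseteq> P \<times> Q" "card P \<le> n" "card Q \<le> n"
    and "\<not> F E"
  shows "card E \<le> max (2 * C) ((real K)\<^sup>2) * real n powr a"
  using PQ \<open>\<not> F E\<close>
proof (induction n arbitrary: E P Q rule: less_induct)
  case (less n E P Q)
  \<comment> \<open>With \<open>2 * C\<close> the half of the edges that remains still meets the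
    threshold \<open>C\<close>; \<open>K^2\<close> covers \<open>n < K\<close>, where the trivial
    bound n^2 suffices.\<close>
  define D where "D = max (2 * C) ((real K)\<^sup>2)"
  have D: "2 * C \<le> D" "(real K)\<^sup>2 \<le> D" "0 < D"
    using C by (auto simp: D_def)
  have finE: "finite E"
    using less.prems by (rule_tac finite_subset) auto
  show ?case
  proof (cases "n < K")
    case True
    have "card E \<le> card (P \<times> Q)"
      using less.prems by (intro card_mono) auto
    also have "\<dots> \<le> n * n"
      using less.prems by (simp add: card_cartesian_product mult_le_mono)
    finally have En: "card E \<le> n * n" .
    show ?thesis
    proof (cases "n = 0")
      case True
      then show ?thesis using En by simp
    next
      case False
      have "real (card E) \<le> real (n * n)"
        using En by (simp only: of_nat_le_iff)
      also have "\<dots> \<le> (real K)\<^sup>2"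
        using True by (simp add: power2_eq_square mult_mono)
      also have "\<dots> \<le> D * 1"
        using D by simp
      also have "\<dots> \<le> D * real n powr a"
        using False a D by (intro mult_left_mono ge_one_powr_ge_zero) auto
      finally show ?thesis by (simp only: D_def)
    qed
  next
    case False
    show ?thesis
    proof (rule ccontr)
      assume "\<not> ?thesis"
      then have e: "D * real n powr a < card E"
        by (simp add: D_def)
      have n: "0 < n" using False K by simp
      define m where "m = n div K"
      have m: "0 < m" "m < n" "m * K \<le> n"
        using False K by (auto simp: m_def div_greater_zero_iff)
      have "n < (m + 1) * K"
        unfolding m_def using K by (simp add: dividend_less_div_times add.commute)
      also have "\<dots> \<le> 2 * K * m"
        using m(1) by (simp add: algebra_simps)
      finally have nm: "n \<le> 2 * K * m" by simp
      have "0 \<le> D * real n powr a" using D by simp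
      then have ne: "E \<noteq> {}" using e by auto
      define c where "c = D * real m powr a"
      have c0: "0 \<le> c" using D by (simp add: c_def)
      have block: "card (E \<inter> A \<times> B) \<le> c" if "A \<subseteq> P" "B \<subseteq> Q" "card A \<le> m" "card B \<le> m" for A B
        unfolding c_def D_def
      proof (rule less.IH[OF m(2)])
        show "\<not> F (E \<inter> A \<times> B)"
          using mono less.prems(7) by blast
        show "finite A" "finite B" "A \<inter> B = {}"
          using that less.prems finite_subset by blast+
      qed (use that in auto)
      \<comment> \<open>Passing from \<open>n\<close> to \<open>m \<le> n / K\<close> gains a factor
        \<open>K powr a\<close>, of which the \<open>2 * K\<close> blocks on one side use up
        \<open>2 * K\<close>. Since \<open>K powr (a - 1)\<close> is at least 8, each side accounts
        for at most a quarter of the edges.\<close>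
      have c_le: "2 * K * c \<le> card E / 4"
      proof -
        have "real K powr a = real K * real K powr (a - 1)"
          using K by (simp add: powr_diff)
        then have "8 * (real K * c) \<le> real K powr a * c"
          using K c0 mult_right_mono[OF K(2), of "real K * c"] by (simp add: mult.assoc mult.left_commute)
        also have "\<dots> = D * (real m * real K) powr a"
          using m K by (simp add: c_def powr_mult)
        also have "\<dots> \<le> D * real n powr a"
        proof -
          have "real m * real K \<le> real n"
            using m(3) by (metis of_nat_le_iff of_nat_mult)
          then show ?thesis
            using D a by (intro mult_left_mono powr_mono2) auto
        qed
        also have "\<dots> \<le> card E"
          using e by simp
        finally show ?thesis by simp
      qed
      define S where "S = {p. card E / m < card {z \<in> E. fst z = p}}"
      define T where "T = {q. card E / m < card {z \<in> E. snd z = q}}"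
      have cardST: "card S \<le> m" "card T \<le> m"
        unfolding S_def T_def by (rule high_degree[OF finE m(1) ne])+
      have "S \<subseteq> fst ` E" "T \<subseteq> snd ` E"
        unfolding S_def T_def by (rule high_degree[OF finE m(1) ne])+
      moreover have "fst ` E \<subseteq> P" "snd ` E \<subseteq> Q"
        using less.prems(4) by auto
      ultimately have ST: "S \<subseteq> P" "T \<subseteq> Q"
        by (meson order_trans)+
      have "real (card (E \<inter> S \<times> Q)) \<le> real (2 * K) * c"
      proof (rule subadditive_blocks[of Q "2 * K" m "\<lambda>B. real (card (E \<inter> S \<times> B))" c])
        fix A B assume "A \<subseteq> Q" "B \<subseteq> Q"
        have "E \<inter> S \<times> (A \<union> B) = (E \<inter> S \<times> A) \<union> (E \<inter> S \<times> B)" by auto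
        then have "card (E \<inter> S \<times> (A \<union> B)) \<le> card (E \<inter> S \<times> A) + card (E \<inter> S \<times> B)"
          using card_Un_le[of "E \<inter> S \<times> A" "E \<inter> S \<times> B"] by simp
        then show "real (card (E \<inter> S \<times> (A \<union> B))) \<le> real (card (E \<inter> S \<times> A)) + real (card (E \<inter> S \<times> B))"
          by linarith
      qed (use less.prems nm block ST cardST c0 in auto)
      moreover have "real (card (E \<inter> P \<times> T)) \<le> real (2 * K) * c"
      proof (rule subadditive_blocks[of P "2 * K" m "\<lambda>B. real (card (E \<inter> B \<times> T))" c])
        fix A B assume "A \<subseteq> P" "B \<subseteq> P"
        have "E \<inter> (A \<union> B) \<times> T = (E \<inter> A \<times> T) \<union> (E \<inter> B \<times> T)" by auto
        then have "card (E \<inter> (A \<union> B) \<times> T) \<le> card (E \<inter> A \<times> T) + card (E \<inter> B \<times> T)"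
          using card_Un_le[of "E \<inter> A \<times> T" "E \<inter> B \<times> T"] by simp
        then show "real (card (E \<inter> (A \<union> B) \<times> T)) \<le> real (card (E \<inter> A \<times> T)) + real (card (E \<inter> B \<times> T))"
          by linarith
      qed (use less.prems nm block ST cardST c0 in auto)
      moreover
      define E' where "E' = E \<inter> (P - S) \<times> (Q - T)"
      have "card E \<le> card (E' \<union> (E \<inter> S \<times> Q \<union> E \<inter> P \<times> T))"
        using less.prems(4) finE by (intro card_mono) (auto simp: E'_def)
      then have "card E \<le> card E' + (card (E \<inter> S \<times> Q) + card (E \<inter> P \<times> T))"
        using order_trans[OF card_Un_le add_left_mono[OF card_Un_le]] order_trans by blast
      ultimately have e': "card E \<le> 2 * real (card E')"
        using c_le by simp
      \<comment> \<open>Of the factor 4, one 2 comes from \<open>n \<le> 2 * K * m\<close> and the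
        other from \<open>card E \<le> 2 * card E'\<close>.\<close>
      have deg: "card E / m \<le> 4 * real K * card E' / n"
      proof -
        have "card E / m \<le> real (card E) * (2 * real K) / n"
        proof -
          have "real n \<le> real (2 * K * m)"
            using nm by (simp only: of_nat_le_iff)
          then have "card E * real n \<le> card E * real (2 * K * m)"
            by (intro mult_left_mono) auto
          then show ?thesis
            using m(1) n by (simp add: field_simps)
        qed
        also have "\<dots> \<le> (2 * real (card E')) * (2 * real K) / n"
          by (intro divide_right_mono mult_right_mono e') auto
        finally show ?thesis by (simp add: mult_ac)
      qed
      have "C * real n powr a \<le> card E'"
      proof -
        have "2 * C * real n powr a \<le> D * real n powr a"
          using D by (intro mult_right_mono) auto
        then show ?thesis using e e' by simp
      qed
      moreover have "real (card {q. (p, q) \<in> E'}) \<le> 4 * real K * card E' / n" for p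
      proof (cases "p \<in> S")
        case True
        then have "{q. (p, q) \<in> E'} = {}" by (auto simp: E'_def)
        then show ?thesis by (simp only: card.empty) simp
      next
        case False
        have "card {q. (p, q) \<in> E'} = card (Pair p ` {q. (p, q) \<in> E'})"
          by (intro card_image[symmetric] inj_onI) auto
        also have "\<dots> \<le> card {z \<in> E. fst z = p}"
          using finE by (intro card_mono) (auto simp: E'_def)
        finally have "real (card {q. (p, q) \<in> E'}) \<le> card E / m"
          using False by (simp add: S_def)
        then show ?thesis using deg by linarith
      qed
      moreover have "real (card {p. (p, q) \<in> E'}) \<le> 4 * real K * card E' / n" for q
      proof (cases "q \<in> T")
        case True
        then have "{p. (p, q) \<in> E'} = {}" by (auto simp: E'_def)
        then show ?thesis by (simp only: card.empty) simp
      next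
        case False
        have "card {p. (p, q) \<in> E'} = card ((\<lambda>p. (p, q)) ` {p. (p, q) \<in> E'})"
          by (intro card_image[symmetric] inj_onI) auto
        also have "\<dots> \<le> card {z \<in> E. snd z = q}"
          using finE by (intro card_mono) (auto simp: E'_def)
        finally have "real (card {p. (p, q) \<in> E'}) \<le> card E / m"
          using False by (simp add: T_def)
        then show ?thesis using deg by linarith
      qed
      moreover have "E' \<subseteq> P \<times> Q"
        using less.prems(4) by (auto simp: E'_def)
      ultimately have "F E'"
        using reg[unfolded regular_forces_def, rule_format, of P Q E' n] less.prems n by simp
      moreover have "E' \<subseteq> E" by (auto simp: E'_def)
      ultimately show False
        using mono less.prems(7) by blast
    qed
  qed
qed

section \<open>Bipartite subgraphs and the conclusion\<close>

lemma max_cut: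
  assumes "finite V" "\<And>e. e \<in> S \<Longrightarrow> e \<subseteq> V \<and> card e = 2"
  shows "\<exists>P\<subseteq>V. card S \<le> 2 * card {e \<in> S. e \<inter> P \<noteq> {} \<and> e - P \<noteq> {}}"
  using assms
proof (induction V arbitrary: S rule: finite_induct)
  case empty
  then have "S = {}" by fastforce
  then show ?case by simp
next
  case (insert v V)
  let ?S0 = "{e \<in> S. v \<notin> e}"
  \<comment> \<open>Edges avoiding \<open>v\<close> are cut by induction. Placing \<open>v\<close>
    opposite to the larger part of its neighbourhood \<open>N\<close> cuts at least half of the
    edges at \<open>v\<close> as well.\<close>
  define N where "N = {u \<in> V. {v, u} \<in> S}"
  have S0: "e \<subseteq> V \<and> card e = 2" if "e \<in> ?S0" for e
    using that insert.prems by blast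
  from insert.IH[OF S0] obtain P where P: "P \<subseteq> V"
    "card ?S0 \<le> 2 * card {e \<in> ?S0. e \<inter> P \<noteq> {} \<and> e - P \<noteq> {}}"
    by blast
  have finN: "finite N" using insert.hyps by (simp add: N_def)
  have finS: "finite S"
    using insert by (intro finite_subset[of S "Pow (insert v V)"]) auto
  have inj: "inj_on (\<lambda>u. {v, u}) N"
    using insert.hyps by (auto simp: inj_on_def N_def doubleton_eq_iff)
  have star: "S = ?S0 \<union> (\<lambda>u. {v, u}) ` N"
  proof (intro equalityI subsetI)
    fix e assume e: "e \<in> S"
    show "e \<in> ?S0 \<union> (\<lambda>u. {v, u}) ` N"
    proof (cases "v \<in> e")
      case True
      have "card e = 2" "e \<subseteq> insert v V" using insert.prems e by auto
      then obtain u where "e = {v, u}" "u \<noteq> v"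
        using True by (auto simp: card_2_iff)
      then have "u \<in> N" using e \<open>e \<subseteq> _\<close> by (auto simp: N_def)
      then show ?thesis using \<open>e = {v, u}\<close> by blast
    qed (use e in auto)
  qed (auto simp: N_def)
  have "card S \<le> card ?S0 + card ((\<lambda>u. {v, u}) ` N)"
    using star card_Un_le by metis
  then have cS: "card S \<le> card ?S0 + card N"
    using inj by (simp add: card_image)
  have bound: "card {e \<in> ?S0. e \<inter> P \<noteq> {} \<and> e - P \<noteq> {}} + card M
      \<le> card {e \<in> S. e \<inter> P' \<noteq> {} \<and> e - P' \<noteq> {}}"
    if M: "M \<subseteq> N" and P': "P' = P \<or> P' = insert v P"
      and cut: "\<And>u. u \<in> M \<Longrightarrow> {v, u} \<inter> P' \<noteq> {} \<and> {v, u} - P' \<noteq> {}" for M P'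
  proof -
    let ?c = "{e \<in> ?S0. e \<inter> P \<noteq> {} \<and> e - P \<noteq> {}}"
    have "card ?c + card M = card ?c + card ((\<lambda>u. {v, u}) ` M)"
      using inj_on_subset[OF inj M] by (simp add: card_image)
    also have "\<dots> = card (?c \<union> (\<lambda>u. {v, u}) ` M)"
      using finS finite_subset[OF M finN] by (intro card_Un_disjoint[symmetric]) auto
    also have "\<dots> \<le> card {e \<in> S. e \<inter> P' \<noteq> {} \<and> e - P' \<noteq> {}}"
    proof (rule card_mono)
      show "?c \<union> (\<lambda>u. {v, u}) ` M \<subseteq> {e \<in> S. e \<inter> P' \<noteq> {} \<and> e - P' \<noteq> {}}"
      proof (rule Un_least)
        show "?c \<subseteq> {e \<in> S. e \<inter> P' \<noteq> {} \<and> e - P' \<noteq> {}}"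
          using P' by auto
        show "(\<lambda>u. {v, u}) ` M \<subseteq> {e \<in> S. e \<inter> P' \<noteq> {} \<and> e - P' \<noteq> {}}"
          using cut M by (auto simp: N_def)
      qed
    qed (use finS in simp)
    finally show ?thesis .
  qed
  have "N = N \<inter> P \<union> (N - P)" by blast
  then have split: "card N \<le> card (N \<inter> P) + card (N - P)"
    using card_Un_le by metis
  have vP: "v \<notin> P" using P(1) insert.hyps by blast
  show ?case
  proof (cases "card (N - P) \<le> card (N \<inter> P)")
    case True
    have "card {e \<in> ?S0. e \<inter> P \<noteq> {} \<and> e - P \<noteq> {}} + card (N \<inter> P)
        \<le> card {e \<in> S. e \<inter> P \<noteq> {} \<and> e - P \<noteq> {}}"
      using vP by (intro bound) auto
    then have "card S \<le> 2 * card {e \<in> S. e \<inter> P \<noteq> {} \<and> e - P \<noteq> {}}"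
      using True cS split P(2) by linarith
    then show ?thesis using P(1) by blast
  next
    case False
    have "card {e \<in> ?S0. e \<inter> P \<noteq> {} \<and> e - P \<noteq> {}} + card (N - P)
        \<le> card {e \<in> S. e \<inter> insert v P \<noteq> {} \<and> e - insert v P \<noteq> {}}"
      using insert.hyps by (intro bound) (auto simp: N_def)
    then have "card S \<le> 2 * card {e \<in> S. e \<inter> insert v P \<noteq> {} \<and> e - insert v P \<noteq> {}}"
      using False cS split P(2) by linarith
    then show ?thesis using P(1) by blast
  qed
qed

lemma bipartite_half:
  assumes "simple_graph G"
  obtains P Q E where "P \<union> Q = fst G" "P \<inter> Q = {}" "E \<subseteq> P \<times> Q"
    "snd (edge_graph E) \<subseteq> snd G" "card (snd G) \<le> 2 * card E"
proof -
  have fin: "finite (fst G)" and edges: "\<And>e. e \<in> snd G \<Longrightarrow> e \<subseteq> fst G \<and> card e = 2"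
    using assms by (auto simp: simple_graph_def)
  obtain P where P: "P \<subseteq> fst G" "card (snd G) \<le> 2 * card {e \<in> snd G. e \<inter> P \<noteq> {} \<and> e - P \<noteq> {}}"
    using max_cut[OF fin edges] by blast
  define E where "E = {(p, q). p \<in> P \<and> q \<in> fst G - P \<and> {p, q} \<in> snd G}"
  have "{e \<in> snd G. e \<inter> P \<noteq> {} \<and> e - P \<noteq> {}} \<subseteq> (\<lambda>(p, q). {p, q}) ` E"
  proof
    fix e assume e: "e \<in> {e \<in> snd G. e \<inter> P \<noteq> {} \<and> e - P \<noteq> {}}"
    then obtain p q where pq: "p \<in> e" "p \<in> P" "q \<in> e" "q \<notin> P" by blast
    have "e \<subseteq> fst G" "card e = 2" using edges e by auto
    then have "e = {p, q}"
      using pq by (auto simp: card_2_iff)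
    then have "(p, q) \<in> E"
      using e pq \<open>e \<subseteq> fst G\<close> by (auto simp: E_def)
    then show "e \<in> (\<lambda>(p, q). {p, q}) ` E"
      using \<open>e = {p, q}\<close> by force
  qed
  moreover have "E \<subseteq> fst G \<times> fst G"
    using P(1) by (auto simp: E_def)
  then have "finite E"
    using fin finite_subset by blast
  ultimately have "card {e \<in> snd G. e \<inter> P \<noteq> {} \<and> e - P \<noteq> {}} \<le> card E"
    by (intro surj_card_le)
  then show thesis
    using P by (intro that[of P "fst G - P" E]) (auto simp: E_def edge_graph_def)
qed

theorem proposition3p1:
  fixes k t :: nat
  assumes "k \<ge> 2" and "t \<ge> 2"
  shows "(\<lambda>n. real (extremal_number n (E_plus_graph k t)))
           \<in> O(\<lambda>n. real n powr ((3 * real k - 1) / (2 * real k - 1)))"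
proof -
  let ?H = "E_plus_graph k t"
  define a where "a = (3 * real k - 1) / (2 * real k - 1)"
  have a: "1 < a"
    using assms(1) by (simp add: a_def field_simps)
  \<comment> \<open>\<open>K\<close> depends on \<open>k\<close> only, so the constant
    \<open>C\<close> for the degree ratio \<open>4 * K\<close> depends on \<open>k\<close> and
    \<open>t\<close> only.\<close>
  obtain K :: nat where K: "max 2 (8 powr (1 / (a - 1))) \<le> real K"
    using real_arch_simple by blast
  have "8 = (8 powr (1 / (a - 1))) powr (a - 1)"
    using a by (simp add: powr_powr)
  also have "\<dots> \<le> real K powr (a - 1)"
    using K a by (intro powr_mono2) auto
  finally have K': "2 \<le> K" "8 \<le> real K powr (a - 1)"
    using K by auto
  obtain C where C: "0 < C"
    and reg: "regular_forces (\<lambda>E :: (nat \<times> nat) set. contains_copy (edge_graph E) ?H) (4 * real K) a C"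
    using regular_case[of k t "4 * real K", folded a_def] assms K'(1) by auto
  let ?M = "2 * max (2 * C) ((real K)\<^sup>2)"
  have bound: "real (card (snd G)) \<le> ?M * real n powr a"
    if G: "simple_graph G" "card (fst G) = n" "\<not> contains_copy G ?H" for G :: "nat graph" and n
  proof -
    obtain P Q E where PQ: "P \<union> Q = fst G" "P \<inter> Q = {}" "E \<subseteq> P \<times> Q"
      "snd (edge_graph E) \<subseteq> snd G" "card (snd G) \<le> 2 * card E"
      using bipartite_half[OF G(1)] by blast
    have fin: "finite (fst G)"
      using G(1) by (simp add: simple_graph_def)
    have free: "\<not> contains_copy (edge_graph E) ?H"
    proof
      assume "contains_copy (edge_graph E) ?H"
      moreover have "fst (edge_graph E) \<subseteq> fst G"
        using PQ(1,3) by (auto simp: edge_graph_def Field_def)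
      ultimately have "contains_copy G ?H"
        using PQ(4) unfolding contains_copy_def by (meson order_trans subsetD)
      with G(3) show False ..
    qed
    have "finite P" "finite Q" "card P \<le> n" "card Q \<le> n"
      using fin PQ(1) G(2) by (auto intro: card_mono finite_subset)
    from regularization[OF a K' C contains_copy_edge_graph_mono reg this(1,2) PQ(2,3) this(3,4) free]
    have "card E \<le> max (2 * C) ((real K)\<^sup>2) * real n powr a" .
    then show ?thesis
      using PQ(5) by linarith
  qed
  have "real (extremal_number n ?H) \<le> ?M * real n powr a" for n
  proof -
    have "snd ?H \<noteq> {}"
      by (simp add: E_plus_graph_def)
    then have "extremal_number n ?H \<in> {card (snd G) |G :: nat graph.
        simple_graph G \<and> card (fst G) = n \<and> \<not> contains_copy G ?H}"
      unfolding extremal_number_def by (intro Max_in finite_H_free_sizes H_free_sizes_nonempty)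
    then obtain G :: "nat graph" where "extremal_number n ?H = card (snd G)"
      "simple_graph G" "card (fst G) = n" "\<not> contains_copy G ?H"
      by blast
    then show ?thesis
      using bound[of G n] by simp
  qed
  then show ?thesis
    unfolding a_def[symmetric] by (intro bigoI[of _ ?M]) simp
qed

end
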